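(* Assume Hypotheses 1, 2 and 3 (stated in the context). Let $K := \Pi_\perp(\Gamma) = \Pi_\perp(U)$. Then $\Gamma$ contains every subset of $U$ that is positively invariant under the flow of the system, and there exists a $C^1$ function $h : K \to \mathbb{R}^n$ such that $\Gamma = \{(h(z), z) : z \in K\}$. Moreover, $\|h(z_2) - h(z_1)\| < \|z_2 - z_1\|$ for all $z_1, z_2 \in K$ with $z_1 \neq z_2$, and $\|Dh(z)\| < 1$ for all $z \in K$.
   Context: Consider the system $\dot a = f(a,z)$, $\dot z = g(a,z)$ with $(a,z)\in\mathbb{R}^n\times\mathbb{R}^m$; write $x=(a,z)$, $X=\mathbb{R}^n\times\mathbb{R}^m$. $\langle\cdot,\cdot\rangle$ and $\|\cdot\|$ are the Euclidean inner product and norm (and induced operator norm). $\Phi(t,x)$ denotes the (local) flow of the system on its domain. A set $\Gamma\subseteq U$ is positively invariant if for every $x\in\Gamma$, $\Phi(t,x)$ is defined for all $t\ge0$ and $\Phi(t,\Gamma)\subseteq\Gamma$ for all $t\ge 0$. Projections: $\Pi(a,z)=a$, $\Pi_\perp(a,z)=z$. For $x=(a,z)$ and $d>0$, $\mathbb{B}_d(x)=\{(a',z'): \|a'-a\|\le d,\ \|z'-z\|\le d\}$. Define $\mathcal{L}(x_1,x_2)=\|a_2-a_1\|^2-\|z_2-z_1\|^2$ for $x_i=(a_i,z_i)$, and the cone $\mathcal{C}(x)=\{x'\in X:\mathcal{L}(x',x)\ge 0\}$. Hypothesis 1: $U$ is an open, convex subset of $\mathbb{R}^n\times\mathbb{R}^m$,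 and there exists $d>0$ such that $\mathcal{C}(x)\cap U\subset\mathbb{B}_d(x)$ for all $x\in U$. Hypothesis 2: $f,g$ are $C^1$ on $U$, and there exist a continuous positive function $\alpha:U\to\mathbb{R}$, a continuous nonnegative function $\ell:U\to\mathbb{R}$ and a constant $c_1>0$ such that for all $x\in U$: $\langle a', D_af(x)a'\rangle\ge\alpha(x)\|a'\|^2$ for all $a'\in\mathbb{R}^n$; $\langle z', D_zg(x)z'\rangle\le\ell(x)\|z'\|^2$ for all $z'\in\mathbb{R}^m$; and $\alpha(x)\ge \ell(x)+\|D_zf(x)\|+\|D_ag(x)\|+c_1$. Hypothesis 3: $\Gamma\subset U$ is positively invariant under the flow and $\Pi_\perp(\Gamma)=\Pi_\perp(U)$. *)

theory Defs
  imports "HOL-Analysis.Analysis"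
begin

definition Lfun :: "((real^'n) \<times> (real^'m)) \<Rightarrow> ((real^'n) \<times> (real^'m)) \<Rightarrow> real" where
  "Lfun x1 x2 = (norm (fst x2 - fst x1))\<^sup>2 - (norm (snd x2 - snd x1))\<^sup>2"

definition lcone :: "((real^'n) \<times> (real^'m)) \<Rightarrow> ((real^'n) \<times> (real^'m)) set" where
  "lcone x = {x'. Lfun x' x \<ge> 0}"

definition boxd :: "real \<Rightarrow> ((real^'n) \<times> (real^'m)) \<Rightarrow> ((real^'n) \<times> (real^'m)) set" where
  "boxd d x = {x'. norm (fst x' - fst x) \<le> d \<and> norm (snd x' - snd x) \<le> d}"

definition vfield :: "((real^'n) \<times> (real^'m) \<Rightarrow> real^'n) \<Rightarrow> ((real^'n) \<times> (real^'m) \<Rightarrow> real^'m)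
    \<Rightarrow> (real^'n) \<times> (real^'m) \<Rightarrow> (real^'n) \<times> (real^'m)" where
  "vfield f g x = (f x, g x)"

definition fwd_solution :: "((real^'n) \<times> (real^'m) \<Rightarrow> real^'n) \<Rightarrow> ((real^'n) \<times> (real^'m) \<Rightarrow> real^'m)
    \<Rightarrow> ((real^'n) \<times> (real^'m)) set \<Rightarrow> (real \<Rightarrow> (real^'n) \<times> (real^'m)) \<Rightarrow> bool" where
  "fwd_solution f g U \<phi> \<longleftrightarrow>
     (\<forall>t\<ge>0. \<phi> t \<in> U \<and> (\<phi> has_vector_derivative vfield f g (\<phi> t)) (at t within {0..}))"

text \<open>Positive invariance: from every point of S the flow exists for all t \<ge> 0
  (there is a forward solution in U) and stays in S (every forward solution stays in S;
  solutions are unique since f, g are C^1).\<close>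
definition pos_invariant :: "((real^'n) \<times> (real^'m) \<Rightarrow> real^'n) \<Rightarrow> ((real^'n) \<times> (real^'m) \<Rightarrow> real^'m)
    \<Rightarrow> ((real^'n) \<times> (real^'m)) set \<Rightarrow> ((real^'n) \<times> (real^'m)) set \<Rightarrow> bool" where
  "pos_invariant f g U S \<longleftrightarrow> S \<subseteq> U \<and>
     (\<forall>x\<in>S. (\<exists>\<phi>. fwd_solution f g U \<phi> \<and> \<phi> 0 = x) \<and>
             (\<forall>\<phi>. fwd_solution f g U \<phi> \<and> \<phi> 0 = x \<longrightarrow> (\<forall>t\<ge>0. \<phi> t \<in> S)))"

end

theory Submission
  imports Defs
begin

text \<open>
  Along the difference of two solutions, \<open>L = |a|\<^sup>2 - |z|\<^sup>2\<close> grows at a uniform rate wherever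
  \<open>L \<ge> 0\<close>. Two distinct points of invariant sets with \<open>L \<ge> 0\<close> would therefore drift apart beyond
  the bound \<open>d\<close> on the cones, so \<open>L < 0\<close>: \<open>\<Gamma>\<close> is the graph of a strict contraction \<open>h\<close> and contains
  every invariant set.

  Smoothness of \<open>h\<close> is obtained without the variational equation. Let \<open>W\<close> be a linear combination of
  differences of trajectories in \<open>\<Gamma>\<close> near a reference trajectory whose \<open>z\<close>-component vanishes at
  time 0. Each difference satisfies \<open>|a| \<le> |z|\<close>, hence grows at most at the rate \<open>ell + |D\<^sub>a g|\<close>,
  whereas the \<open>a\<close>-component of \<open>W\<close> grows at least at the rate \<open>\<alpha> - |D\<^sub>z f|\<close>, which is larger by \<open>c1\<close>.
  Over a long time this forces \<open>W\<close> to be small at time 0 relative to the differences, which says that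
  \<open>h\<close> is strictly differentiable. Finally, the ratio \<open>|a| / |z| \<le> 1\<close> of a difference increases
  at a uniform rate when close to 1, so it starts away from 1, and \<open>|Dh| < 1\<close>.
\<close>

subsection \<open>Calculus preliminaries\<close>

lemma has_real_derivative_norm_power2:
  fixes u :: "real \<Rightarrow> 'a::real_inner"
  assumes "(u has_vector_derivative u') (at t within S)"
  shows "((\<lambda>t. (norm (u t))\<^sup>2) has_real_derivative 2 * inner (u t) u') (at t within S)"
proof -
  have "((\<lambda>t. inner (u t) (u t)) has_derivative
      (\<lambda>h. inner (u t) (h *\<^sub>R u') + inner (h *\<^sub>R u') (u t))) (at t within S)"
    using assms unfolding has_vector_derivative_def by (intro has_derivative_inner) 
  then show ?thesis
    unfolding has_field_derivative_def power2_norm_eq_inner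
    by (rule has_derivative_eq_rhs) (auto simp: inner_commute algebra_simps fun_eq_iff)
qed

lemma first_time_in_closed_set:
  fixes a b :: real
  assumes C: "closed C" and t: "t \<in> {a..b}" "t \<in> C"
  obtains s where "s \<in> {a..t}" "s \<in> C" "\<And>r. \<lbrakk>a \<le> r; r < s\<rbrakk> \<Longrightarrow> r \<notin> C"
proof -
  have "compact ({a..t} \<inter> C)"
    using C by (intro compact_Int_closed) auto
  moreover have "{a..t} \<inter> C \<noteq> {}"
    using t by auto
  ultimately obtain s where s: "s \<in> {a..t} \<inter> C" "\<And>r. r \<in> {a..t} \<inter> C \<Longrightarrow> s \<le> r"
    by (meson compact_attains_inf)
  show ?thesis
  proof
    show "r \<notin> C" if "a \<le> r" "r < s" for r
      using s(2)[of r] s(1) that by auto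
  qed (use s in auto)
qed

text \<open>A bootstrap argument: up to the first time at which one of the two functions fails to be
  positive, both are nondecreasing, so neither can have dropped below its positive initial value. It
  serves derivative estimates that are available only while both quantities are positive.\<close>

lemma both_stay_positive:
  fixes P R :: "real \<Rightarrow> real"
  assumes cP: "continuous_on {a..b} P" and cR: "continuous_on {a..b} R"
    and P0: "P a > 0" and R0: "R a > 0"
    and dP: "\<And>t. \<lbrakk>a < t; t < b; P t > 0; R t > 0\<rbrakk> \<Longrightarrow> \<exists>y. (P has_real_derivative y) (at t) \<and> y \<ge> 0"
    and dR: "\<And>t. \<lbrakk>a < t; t < b; P t > 0; R t > 0\<rbrakk> \<Longrightarrow> \<exists>y. (R has_real_derivative y) (at t) \<and> y \<ge> 0"
    and t: "t \<in> {a..b}"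
  shows "P t > 0 \<and> R t > 0"
proof (rule ccontr)
  define C where "C = {s \<in> {a..b}. min (P s) (R s) \<le> 0}"
  assume "\<not> (P t > 0 \<and> R t > 0)"
  then have "t \<in> C"
    using t by (auto simp: C_def)
  moreover have "closed C"
    unfolding C_def by (intro continuous_on_closed_Collect_le continuous_on_min cP cR continuous_on_const) auto
  ultimately obtain s where s: "s \<in> {a..t}" "s \<in> C" "\<And>r. \<lbrakk>a \<le> r; r < s\<rbrakk> \<Longrightarrow> r \<notin> C"
    using t first_time_in_closed_set by metis
  have pos: "P r > 0 \<and> R r > 0" if "a \<le> r" "r < s" for r
    using s(3)[OF that] s(1) t that by (auto simp: C_def)
  have "a \<le> s"
    using s(1) by simp
  have sub: "{a..s} \<subseteq> {a..b}"
    using s(1) t by auto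
  have "P a \<le> P s"
    by (rule DERIV_nonneg_imp_increasing_open[OF \<open>a \<le> s\<close> _ continuous_on_subset[OF cP sub]])
      (use pos dP s(1) t in \<open>auto simp: less_imp_le\<close>)
  moreover have "R a \<le> R s"
    by (rule DERIV_nonneg_imp_increasing_open[OF \<open>a \<le> s\<close> _ continuous_on_subset[OF cR sub]])
      (use pos dR s(1) t in \<open>auto simp: less_imp_le\<close>)
  ultimately show False
    using P0 R0 s(2) by (auto simp: C_def)
qed

lemma linear_growth:
  fixes P :: "real \<Rightarrow> real"
  assumes ab: "a \<le> b" and cP: "continuous_on {a..b} P"
    and dP: "\<And>t. \<lbrakk>a < t; t < b\<rbrakk> \<Longrightarrow> \<exists>y. (P has_real_derivative y) (at t) \<and> y \<ge> k"
  shows "P b \<ge> P a + k * (b - a)"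
proof -
  have "P a - k * a \<le> P b - k * b"
  proof (rule DERIV_nonneg_imp_increasing_open[OF ab])
    fix t assume "a < t" "t < b"
    then obtain y where "(P has_real_derivative y) (at t)" "y \<ge> k"
      using dP by blast
    then show "\<exists>y. ((\<lambda>t. P t - k * t) has_real_derivative y) (at t) \<and> 0 \<le> y"
      by (intro exI[of _ "y - k"]) (auto intro!: derivative_eq_intros)
  qed (intro continuous_intros cP)
  then show ?thesis
    by (simp add: algebra_simps)
qed

section \<open>Uniform linearization near compact sets and strict differentiability\<close>

lemma uniform_nearness_on_compact:
  fixes H :: "'a::euclidean_space \<Rightarrow> 'b::metric_space"
  assumes "open U" "compact K" "K \<subseteq> U" and cont: "continuous_on U H" and e: "e > 0"
  obtains r where "r > 0" "\<And>x. x \<in> K \<Longrightarrow> cball x r \<subseteq> U"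
    "\<And>x y. \<lbrakk>x \<in> K; y \<in> cball x r\<rbrakk> \<Longrightarrow> dist (H y) (H x) < e"
proof (cases "K = {}")
  case True
  then show ?thesis using that[of 1] by auto
next
  case False
  obtain r0 where r0: "r0 > 0" "{x. infdist x K \<le> r0} \<subseteq> U"
    using compact_in_open_separated[OF False] assms(1-3) by metis
  \<comment> \<open>Uniform continuity is needed at points \<open>y\<close> off \<open>K\<close> as
    well, so it is taken on a compact neighbourhood of \<open>K\<close> inside \<open>U\<close> and
    not on \<open>K\<close> itself.\<close>
  define N where "N = {x. infdist x K \<le> r0}"
  have "compact N"
    unfolding N_def using False assms r0 by (intro compact_infdist_le) auto
  then have "uniformly_continuous_on N H"
    using cont r0(2) compact_uniformly_continuous continuous_on_subset unfolding N_def by blast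
  then obtain r1 where r1: "r1 > 0" "\<And>x y. \<lbrakk>x \<in> N; y \<in> N; dist y x < r1\<rbrakk> \<Longrightarrow> dist (H y) (H x) < e"
    using e unfolding uniformly_continuous_on_def by metis
  \<comment> \<open>The bound \<open>r0\<close> keeps the balls inside \<open>N\<close>; halving
    \<open>r1\<close> turns the closed ball condition into the strict inequality of uniform
    continuity.\<close>
  define r where "r = min r0 (r1/2)"
  have "r > 0" using r0 r1 by (auto simp: r_def)
  have sub: "cball x r \<subseteq> N" if "x \<in> K" for x
    unfolding N_def r_def using infdist_le[OF that] by (fastforce simp: dist_commute intro: order_trans)
  show ?thesis
  proof
    show "cball x r \<subseteq> U" if "x \<in> K" for x
      using sub[OF that] r0(2) by (auto simp: N_def)
    fix x y assume x: "x \<in> K" and y: "y \<in> cball x r"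
    have "dist y x < r1" using y r1(1) by (auto simp: r_def dist_commute)
    moreover have "x \<in> cball x r" using \<open>r > 0\<close> by simp
    ultimately show "dist (H y) (H x) < e"
      using r1(2) sub[OF x] y by blast
  qed (fact \<open>r > 0\<close>)
qed

text \<open>On a small ball around \<open>x\<close> the derivative stays within \<open>e\<close> of
  \<open>F' x\<close>, so the mean value inequality bounds the increments of \<open>F\<close> minus
  its linear part. Both endpoints are free in the ball, and the radius does not depend on
  \<open>x\<close> in \<open>K\<close>; this is what allows linearizing along a whole trajectory at
  once.\<close>

lemma strict_linearization_on_compact:
  fixes F :: "'a::euclidean_space \<Rightarrow> 'b::euclidean_space" and F' :: "'a \<Rightarrow> 'a \<Rightarrow>\<^sub>L 'b"
  assumes "open U" "compact K" "K \<subseteq> U"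
    and der: "\<And>x. x \<in> U \<Longrightarrow> (F has_derivative blinfun_apply (F' x)) (at x)"
    and cont: "continuous_on U F'" and e: "e > 0"
  obtains r where "r > 0"
    "\<And>x y y'. \<lbrakk>x \<in> K; y \<in> cball x r; y' \<in> cball x r\<rbrakk>
      \<Longrightarrow> norm (F y - F y' - F' x (y - y')) \<le> e * norm (y - y')"
proof -
  obtain r where r: "r > 0" "\<And>x. x \<in> K \<Longrightarrow> cball x r \<subseteq> U"
    "\<And>x y. \<lbrakk>x \<in> K; y \<in> cball x r\<rbrakk> \<Longrightarrow> dist (F' y) (F' x) < e"
    using uniform_nearness_on_compact[OF assms(1-3) cont e] by metis
  show ?thesis
  proof
    fix x y y' assume x: "x \<in> K" and y: "y \<in> cball x r" "y' \<in> cball x r"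
    have "norm (F y - F y' - F' x (y - y')) \<le> norm (y - y') * e"
    proof (rule differentiable_bound_linearization[where S="cball x r" and f'="\<lambda>x. blinfun_apply (F' x)"])
      show "y' + t *\<^sub>R (y - y') \<in> cball x r" if "t \<in> {0..1}" for t
        using y that convexD_alt[OF convex_cball, of y' x r y t] by (auto simp: algebra_simps)
      show "(F has_derivative blinfun_apply (F' w)) (at w within cball x r)" if "w \<in> cball x r" for w
        using der r(2)[OF x] that has_derivative_at_withinI by blast
      show "onorm (blinfun_apply (F' w) - blinfun_apply (F' x)) \<le> e" if "w \<in> cball x r" for w
        using less_imp_le[OF r(3)[OF x that]]
        by (simp add: dist_norm norm_blinfun.rep_eq minus_blinfun.rep_eq fun_diff_def)
      show "x \<in> cball x r" using r(1) by simp
    qed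
    then show "norm (F y - F y' - F' x (y - y')) \<le> e * norm (y - y')"
      by (simp add: mult.commute)
  qed (fact r(1))
qed

text \<open>Two linear maps that approximate \<open>h\<close> near \<open>z\<close> with errors
  \<open>e1\<close> and \<open>e2\<close> differ by at most \<open>e1 + e2\<close> in operator norm,
  as a common small increment shows. Maps chosen for errors tending to 0 therefore form a Cauchy
  sequence, and its limit is a strict derivative.\<close>

lemma strict_derivative_from_approximate:
  fixes h :: "'a::euclidean_space \<Rightarrow> 'b::euclidean_space"
  assumes "\<And>e. e > 0 \<Longrightarrow> \<exists>d>0. \<exists>A::'a \<Rightarrow>\<^sub>L 'b. \<forall>y\<in>ball z d. \<forall>w\<in>ball z d.
      norm (h y - h w - A (y - w)) \<le> e * norm (y - w)"
  obtains A :: "'a \<Rightarrow>\<^sub>L 'b" where "\<And>e. e > 0 \<Longrightarrow> \<exists>d>0. \<forall>y\<in>ball z d. \<forall>w\<in>ball z d.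
      norm (h y - h w - A (y - w)) \<le> e * norm (y - w)"
proof -
  have "\<forall>n. \<exists>d A. d > 0 \<and> (\<forall>y\<in>ball z d. \<forall>w\<in>ball z d.
      norm (h y - h w - blinfun_apply A (y - w)) \<le> inverse (real (Suc n)) * norm (y - w))"
    using assms by (metis inverse_positive_iff_positive of_nat_0_less_iff zero_less_Suc)
  then obtain d and A :: "nat \<Rightarrow> 'a \<Rightarrow>\<^sub>L 'b" where d: "\<And>n. d n > 0"
    and A: "\<And>n y w. \<lbrakk>y \<in> ball z (d n); w \<in> ball z (d n)\<rbrakk>
        \<Longrightarrow> norm (h y - h w - A n (y - w)) \<le> inverse (real (Suc n)) * norm (y - w)"
    by metis
  have close: "norm (A m - A n) \<le> inverse (real (Suc m)) + inverse (real (Suc n))" for m n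
  proof (rule norm_blinfun_bound)
    fix v :: 'a
    \<comment> \<open>The scaling moves \<open>z + s v\<close> into both balls; adding 1 to
      \<open>norm v\<close> covers \<open>v = 0\<close>.\<close>
    define s where "s = min (d m) (d n) / (2 * (norm v + 1))"
    have s: "s > 0" using d[of m] d[of n] by (auto simp: s_def intro!: divide_pos_pos add_nonneg_pos)
    have "s * norm v < min (d m) (d n)"
    proof -
      have "s * norm v \<le> s * (norm v + 1)" using s by simp
      also have "\<dots> = min (d m) (d n) / 2"
        using norm_ge_zero[of v] unfolding s_def by (simp add: field_simps add_nonneg_eq_0_iff)
      finally show ?thesis using d[of m] d[of n] by (simp add: min_def split: if_splits)
    qed
    then have *: "z + s *\<^sub>R v \<in> ball z (d m)" "z + s *\<^sub>R v \<in> ball z (d n)"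
      using s by (auto simp: dist_norm)
    have "norm (A m (s *\<^sub>R v) - A n (s *\<^sub>R v)) =
       norm ((h (z + s *\<^sub>R v) - h z - A n (s *\<^sub>R v)) - (h (z + s *\<^sub>R v) - h z - A m (s *\<^sub>R v)))"
      by simp
    also have "\<dots> \<le> norm (h (z + s *\<^sub>R v) - h z - A n (s *\<^sub>R v)) + norm (h (z + s *\<^sub>R v) - h z - A m (s *\<^sub>R v))"
      by (rule norm_triangle_ineq4)
    also have "\<dots> \<le> inverse (real (Suc n)) * norm (s *\<^sub>R v) + inverse (real (Suc m)) * norm (s *\<^sub>R v)"
      using A[of "z + s *\<^sub>R v" n z] A[of "z + s *\<^sub>R v" m z] * d by (intro add_mono) auto
    also have "\<dots> = s * ((inverse (real (Suc m)) + inverse (real (Suc n))) * norm v)"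
      using s by (simp add: algebra_simps)
    finally have "s * norm ((A m - A n) v) \<le> \<dots>"
      using s by (simp add: blinfun.scaleR_right blinfun.diff_left flip: scaleR_diff_right)
    then show "norm ((A m - A n) v) \<le> (inverse (real (Suc m)) + inverse (real (Suc n))) * norm v"
      using s by simp
  qed simp
  have inv0: "(\<lambda>n. inverse (real (Suc n))) \<longlonglongrightarrow> 0"
    by (rule LIMSEQ_inverse_real_of_nat)
  have "Cauchy A"
  proof (rule CauchyI)
    fix e :: real assume "e > 0"
    then obtain N where N: "inverse (real (Suc N)) < e / 2"
      using reals_Archimedean[of "e/2"] by auto
    have "norm (A m - A n) < e" if "m \<ge> N" "n \<ge> N" for m n
    proof -
      have "inverse (real (Suc m)) \<le> inverse (real (Suc N))" "inverse (real (Suc n)) \<le> inverse (real (Suc N))"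
        using that by (auto intro!: le_imp_inverse_le)
      then show ?thesis using close[of m n] N by linarith
    qed
    then show "\<exists>N. \<forall>m\<ge>N. \<forall>n\<ge>N. norm (A m - A n) < e" by blast
  qed
  then obtain L where L: "A \<longlonglongrightarrow> L"
    using Cauchy_convergent convergent_def by blast
  have limit: "norm (L - A n) \<le> inverse (real (Suc n))" for n
  proof (rule LIMSEQ_le)
    show "(\<lambda>m. norm (A m - A n)) \<longlonglongrightarrow> norm (L - A n)"
      by (intro tendsto_intros L)
    show "(\<lambda>m. inverse (real (Suc m)) + inverse (real (Suc n))) \<longlonglongrightarrow> inverse (real (Suc n))"
      using tendsto_add[OF inv0 tendsto_const] by simp
  qed (use close in auto)
  show ?thesis
  proof
    fix e :: real assume "e > 0"
    then obtain n where n: "inverse (real (Suc n)) < e / 2"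
      using reals_Archimedean[of "e/2"] by auto
    have "norm (h y - h w - L (y - w)) \<le> e * norm (y - w)"
      if "y \<in> ball z (d n)" "w \<in> ball z (d n)" for y w
    proof -
      have "norm (h y - h w - L (y - w)) = norm ((h y - h w - A n (y - w)) - (L - A n) (y - w))"
        by (simp add: blinfun.diff_left)
      also have "\<dots> \<le> norm (h y - h w - A n (y - w)) + norm ((L - A n) (y - w))"
        by (rule norm_triangle_ineq4)
      also have "\<dots> \<le> inverse (real (Suc n)) * norm (y - w) + inverse (real (Suc n)) * norm (y - w)"
        by (intro add_mono A that order_trans[OF norm_blinfun] mult_right_mono limit) auto
      also have "\<dots> \<le> e / 2 * norm (y - w) + e / 2 * norm (y - w)"
        using n by (intro add_mono mult_right_mono) auto
      finally show ?thesis by simp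
    qed
    then show "\<exists>d>0. \<forall>y\<in>ball z d. \<forall>w\<in>ball z d. norm (h y - h w - L (y - w)) \<le> e * norm (y - w)"
      using d[of n] by blast
  qed
qed

text \<open>Testing on a short multiple of \<open>v\<close>, the increment of \<open>F\<close> and
  the error of linearization give the constant \<open>C + e\<close> for every \<open>e > 0\<close>.
  Only increments starting at \<open>y\<close> enter. It serves both the continuity of
  \<open>Dh\<close> and the bound on its norm.\<close>

lemma derivative_bound_of_local_lipschitz:
  fixes F :: "'a::real_normed_vector \<Rightarrow> 'b::real_normed_vector"
  assumes der: "(F has_derivative L) (at y)" and r: "r > 0"
    and lip: "\<And>w. w \<in> ball y r \<Longrightarrow> norm (F w - F y) \<le> C * norm (w - y)"
  shows "norm (L v) \<le> C * norm v"
proof (cases "v = 0")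
  case True
  then show ?thesis
    using has_derivative_bounded_linear[OF der] by (simp add: linear_simps)
next
  case False
  interpret L: bounded_linear L by (rule has_derivative_bounded_linear[OF der])
  have "norm (L v) \<le> (C + e) * norm v" if "e > 0" for e
  proof -
    obtain d where d: "d > 0" "\<And>w. norm (w - y) < d \<Longrightarrow> norm (F w - F y - L (w - y)) \<le> e * norm (w - y)"
      using der \<open>e > 0\<close> unfolding has_derivative_at_alt by blast
    define s where "s = min d r / (2 * norm v)"
    have s: "s > 0" using d r False by (simp add: s_def)
    have sv: "norm (s *\<^sub>R v) = min d r / 2"
      using False d r by (simp add: s_def)
    have "norm (L (s *\<^sub>R v)) = norm ((F (y + s *\<^sub>R v) - F y) - (F (y + s *\<^sub>R v) - F y - L (s *\<^sub>R v)))"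
      by simp
    also have "\<dots> \<le> norm (F (y + s *\<^sub>R v) - F y) + norm (F (y + s *\<^sub>R v) - F y - L (s *\<^sub>R v))"
      by (rule norm_triangle_ineq4)
    also have "\<dots> \<le> C * norm (s *\<^sub>R v) + e * norm (s *\<^sub>R v)"
      using lip[of "y + s *\<^sub>R v"] d(2)[of "y + s *\<^sub>R v"] sv d(1) r by (intro add_mono) (auto simp: dist_norm)
    finally have "s * norm (L v) \<le> s * ((C + e) * norm v)"
      using s by (simp add: L.scaleR algebra_simps)
    then show ?thesis using s by simp
  qed
  then have "norm (L v) \<le> C * norm v + e" if "e > 0" for e
    using False that[THEN divide_pos_pos, of "norm v"] by (fastforce simp: distrib_right)
  then show ?thesis by (rule field_le_epsilon)
qed

text \<open>Strictness at \<open>z\<close> says that \<open>h - h' z\<close> has a small Lipschitz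
  constant on a ball around \<open>z\<close>. Its derivative \<open>h' y - h' z\<close> at any
  nearby \<open>y\<close> is then just as small, so continuity of the derivative comes without
  further work.\<close>

lemma C1_from_strict_derivatives:
  fixes h :: "'a::euclidean_space \<Rightarrow> 'b::euclidean_space" and h' :: "'a \<Rightarrow> 'a \<Rightarrow>\<^sub>L 'b"
  assumes S: "open S" and strict: "\<And>z e. \<lbrakk>z \<in> S; e > 0\<rbrakk> \<Longrightarrow> \<exists>d>0. \<forall>y\<in>ball z d. \<forall>w\<in>ball z d.
      norm (h y - h w - h' z (y - w)) \<le> e * norm (y - w)"
  shows "\<And>z. z \<in> S \<Longrightarrow> (h has_derivative h' z) (at z)" and "continuous_on S h'"
proof -
  show der: "(h has_derivative h' z) (at z)" if z: "z \<in> S" for z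
    unfolding has_derivative_at_alt
  proof (intro conjI allI impI)
    fix e :: real assume "e > 0"
    then obtain d where "d > 0" "\<forall>y\<in>ball z d. \<forall>w\<in>ball z d.
      norm (h y - h w - h' z (y - w)) \<le> e * norm (y - w)"
      using strict[OF z, of e] by blast
    then show "\<exists>d>0. \<forall>y. norm (y - z) < d \<longrightarrow> norm (h y - h z - h' z (y - z)) \<le> e * norm (y - z)"
      by (intro exI[of _ d]) (auto simp: dist_norm norm_minus_commute)
  qed (rule blinfun.bounded_linear_right)
  show "continuous_on S h'"
  proof (rule continuous_on_iff[THEN iffD2], intro ballI allI impI)
    fix z and e :: real assume z: "z \<in> S" and "e > 0"
    then obtain d where d: "d > 0" "\<And>y w. \<lbrakk>y \<in> ball z d; w \<in> ball z d\<rbrakk> \<Longrightarrow>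
      norm (h y - h w - h' z (y - w)) \<le> e/2 * norm (y - w)"
      using strict[OF z, of "e/2"] by auto
    have "dist (h' y) (h' z) < e" if y: "y \<in> S" "dist y z < d" for y
    proof -
      define r where "r = d - dist y z"
      have r: "r > 0" "ball y r \<subseteq> ball z d"
        using y by (auto simp: r_def) (metric)
      have D: "((\<lambda>x. h x - h' z x) has_derivative (h' y - h' z)) (at y)"
        by (simp add: minus_blinfun.rep_eq fun_diff_def)
          (intro derivative_intros der y bounded_linear_imp_has_derivative blinfun.bounded_linear_right)
      have "norm ((h' y - h' z) v) \<le> e/2 * norm v" for v
      proof (rule derivative_bound_of_local_lipschitz[OF D r(1)])
        fix w assume "w \<in> ball y r"
        then have "w \<in> ball z d" using r(2) by blast
        then show "norm (h w - h' z w - (h y - h' z y)) \<le> e/2 * norm (w - y)"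
          using d(2)[of w y] y by (auto simp: blinfun.diff_right algebra_simps dist_commute)
      qed
      then have "norm (h' y - h' z) \<le> e/2"
        using \<open>e > 0\<close> by (intro norm_blinfun_bound) auto
      then show ?thesis using \<open>e > 0\<close> by (simp add: dist_norm)
    qed
    then show "\<exists>d>0. \<forall>y\<in>S. dist y z < d \<longrightarrow> dist (h' y) (h' z) < e"
      using d(1) by blast
  qed
qed

section \<open>Exponential weights and linear combinations over a basis\<close>

lemma integrating_factor:
  fixes k :: "real \<Rightarrow> real"
  assumes "continuous_on {0..T} k"
  obtains E where "continuous_on {0..T} E" "E 0 = 1" "\<And>t. E t > 0"
    "\<And>t. \<lbrakk>0 < t; t < T\<rbrakk> \<Longrightarrow> (E has_real_derivative k t * E t) (at t)"
proof
  let ?E = "\<lambda>t. exp (integral {0..t} k)"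
  have D: "(?E has_real_derivative k t * ?E t) (at t within {0..T})" if "t \<in> {0..T}" for t
    using integral_has_real_derivative[OF assms that] by (auto intro!: derivative_eq_intros)
  show "continuous_on {0..T} ?E"
    unfolding continuous_on_eq_continuous_within by (intro ballI DERIV_continuous[OF D])
  show "(?E has_real_derivative k t * ?E t) (at t)" if "0 < t" "t < T" for t
    using D[of t] that at_within_interior[of t "{0..T}"] by simp
qed auto

text \<open>Here \<open>Q i\<close> belongs to a basis increment of length \<open>s\<close> and
  \<open>q\<close> to the increment \<open>v\<close>, all with the same constant \<open>B\<close>.
  Each coefficient is at most \<open>norm v / s\<close>, so every basis term costs no more than
  \<open>q\<close> itself is allowed.\<close>

lemma norm_basis_combination_le:
  fixes v :: "'a::euclidean_space" and q :: "'b::real_normed_vector" and Q :: "'a \<Rightarrow> 'b"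
  assumes "s > 0" "B \<ge> 0" and q: "norm q \<le> B * norm v"
    and Q: "\<And>i. i \<in> Basis \<Longrightarrow> norm (Q i) \<le> B * s"
  shows "norm (q - (\<Sum>i\<in>Basis. (inner v i / s) *\<^sub>R Q i)) \<le> (1 + real DIM('a)) * norm v * B"
proof -
  have "norm ((inner v i / s) *\<^sub>R Q i) \<le> norm v * B" if i: "i \<in> Basis" for i
  proof -
    have "norm ((inner v i / s) *\<^sub>R Q i) = \<bar>inner v i\<bar> * (norm (Q i) / s)"
      using \<open>s > 0\<close> by simp
    also have "\<dots> \<le> norm v * B"
      using Basis_le_norm[OF i, of v] Q[OF i] assms(1,2)
      by (intro mult_mono) (auto simp: divide_le_eq)
    finally show ?thesis .
  qed
  then have "norm (\<Sum>i\<in>Basis. (inner v i / s) *\<^sub>R Q i) \<le> real DIM('a) * (norm v * B)"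
    by (rule sum_norm_bound)
  then show ?thesis
    using norm_triangle_ineq4[of q "\<Sum>i\<in>Basis. (inner v i / s) *\<^sub>R Q i"] q
    by (simp add: algebra_simps)
qed

lemma at_within_Ici: "at t within {0..} = at t" if "t > 0" for t :: real
  using that by (intro at_within_interior) auto

subsection \<open>Expansion inside the cone\<close>

locale cone_expansion =
  fixes f :: "(real^'n) \<times> (real^'m) \<Rightarrow> real^'n"
    and g :: "(real^'n) \<times> (real^'m) \<Rightarrow> real^'m"
    and f' :: "(real^'n) \<times> (real^'m) \<Rightarrow> ((real^'n) \<times> (real^'m)) \<Rightarrow>\<^sub>L (real^'n)"
    and g' :: "(real^'n) \<times> (real^'m) \<Rightarrow> ((real^'n) \<times> (real^'m)) \<Rightarrow>\<^sub>L (real^'m)"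
    and U :: "((real^'n) \<times> (real^'m)) set"
    and \<alpha> ell :: "(real^'n) \<times> (real^'m) \<Rightarrow> real"
    and c1 d :: real
  assumes open_U: "open U" and convex_U: "convex U"
    and cone_in_box: "\<And>x. x \<in> U \<Longrightarrow> lcone x \<inter> U \<subseteq> boxd d x"
    and f_deriv: "\<And>x. x \<in> U \<Longrightarrow> (f has_derivative blinfun_apply (f' x)) (at x)"
    and g_deriv: "\<And>x. x \<in> U \<Longrightarrow> (g has_derivative blinfun_apply (g' x)) (at x)"
    and f'_cont: "continuous_on U f'"
    and g'_cont: "continuous_on U g'"
    and alpha_cont: "continuous_on U \<alpha>"
    and ell_cont: "continuous_on U ell" and ell_nonneg: "\<And>x. x \<in> U \<Longrightarrow> ell x \<ge> 0"
    and c1_pos: "c1 > 0"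
    and Daf: "\<And>x a. x \<in> U \<Longrightarrow> inner a (f' x (a, 0)) \<ge> \<alpha> x * (norm a)\<^sup>2"
    and Dzg: "\<And>x z. x \<in> U \<Longrightarrow> inner z (g' x (0, z)) \<le> ell x * (norm z)\<^sup>2"
    and gap: "\<And>x. x \<in> U \<Longrightarrow>
        \<alpha> x \<ge> ell x + onorm (\<lambda>z. f' x (0, z)) + onorm (\<lambda>a. g' x (a, 0)) + c1"
begin

abbreviation nf where "nf x \<equiv> onorm (\<lambda>z. f' x (0, z))"
abbreviation ng where "ng x \<equiv> onorm (\<lambda>a. g' x (a, 0))"
abbreviation "sol \<equiv> fwd_solution f g U"

section \<open>Quadratic form estimates for the linearized vector field\<close>

lemma bounded_linear_off_diagonal:
  "bounded_linear (\<lambda>z. f' x (0, z))" "bounded_linear (\<lambda>a. g' x (a, 0))"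
  by (intro bounded_linear_compose[OF blinfun.bounded_linear_right] bounded_linear_Pair
      bounded_linear_ident bounded_linear_zero)+

lemma nf_nonneg: "nf x \<ge> 0" and ng_nonneg: "ng x \<ge> 0"
  by (intro onorm_pos_le bounded_linear_off_diagonal)+

lemma inner_f'_ge:
  assumes "x \<in> U"
  shows "inner (fst v) (f' x v) \<ge> \<alpha> x * (norm (fst v))\<^sup>2 - nf x * norm (fst v) * norm (snd v)"
proof -
  have "f' x v = f' x (fst v, 0) + f' x (0, snd v)"
    by (simp flip: blinfun.add_right)
  moreover have "\<bar>inner (fst v) (f' x (0, snd v))\<bar> \<le> norm (fst v) * (nf x * norm (snd v))"
    by (intro order_trans[OF Cauchy_Schwarz_ineq2] mult_left_mono onorm bounded_linear_off_diagonal) auto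
  ultimately show ?thesis
    using Daf[OF assms, of "fst v"] by (simp add: inner_add_right algebra_simps abs_le_iff)
qed

lemma inner_g'_le:
  assumes "x \<in> U"
  shows "inner (snd v) (g' x v) \<le> ell x * (norm (snd v))\<^sup>2 + ng x * norm (fst v) * norm (snd v)"
proof -
  have "g' x v = g' x (fst v, 0) + g' x (0, snd v)"
    by (simp flip: blinfun.add_right)
  moreover have "\<bar>inner (snd v) (g' x (fst v, 0))\<bar> \<le> norm (snd v) * (ng x * norm (fst v))"
    by (intro order_trans[OF Cauchy_Schwarz_ineq2] mult_left_mono onorm bounded_linear_off_diagonal) auto
  ultimately show ?thesis
    using Dzg[OF assms, of "snd v"] by (simp add: inner_add_right algebra_simps abs_le_iff)
qed

text \<open>Inside the cone all of \<open>|a| |z|\<close> and \<open>|z|^2\<close> are at most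
  \<open>|a|^2\<close>, so the losses are absorbed by the dominance of \<open>\<alpha>\<close> and
  \<open>c1\<close> remains. The left side is half the rate of change of
  \<open>|a|^2 - |z|^2\<close> under the linearization at \<open>x\<close>.\<close>

lemma cone_quadratic_form:
  assumes x: "x \<in> U" and v: "norm (snd v) \<le> norm (fst v)"
  shows "inner (fst v) (f' x v) - inner (snd v) (g' x v) \<ge> c1 * (norm (fst v))\<^sup>2"
proof -
  let ?a = "norm (fst v)" and ?z = "norm (snd v)"
  have az: "?a * ?z \<le> ?a\<^sup>2" "?z\<^sup>2 \<le> ?a\<^sup>2"
    using v by (auto simp: power2_eq_square intro: mult_mono)
  have "(ell x + nf x + ng x + c1) * ?a\<^sup>2 \<le> \<alpha> x * ?a\<^sup>2"
    using gap[OF x] by (intro mult_right_mono) auto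
  moreover have "ell x * ?z\<^sup>2 \<le> ell x * ?a\<^sup>2" "nf x * (?a * ?z) \<le> nf x * ?a\<^sup>2" "ng x * (?a * ?z) \<le> ng x * ?a\<^sup>2"
    by (intro mult_left_mono az ell_nonneg[OF x] nf_nonneg ng_nonneg)+
  ultimately show ?thesis
    using inner_f'_ge[OF x, of v] inner_g'_le[OF x, of v] by (simp add: algebra_simps)
qed

text \<open>The scalar mean value theorem is applied to one real function combining \<open>f\<close>
  and \<open>g\<close>, so a single point \<open>w\<close> serves both components. With
  \<open>p = 0\<close> it isolates \<open>g\<close>.\<close>

lemma mean_value:
  assumes "x \<in> U" "y \<in> U"
  obtains w where "w \<in> closed_segment x y" "w \<in> U"
    "inner p (f y - f x) - inner q (g y - g x) = inner p (f' w (y - x)) - inner q (g' w (y - x))"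
proof -
  let ?c = "\<lambda>s::real. x + s *\<^sub>R (y - x)"
  have seg: "?c s \<in> closed_segment x y" if "0 \<le> s" "s \<le> 1" for s
    using that by (auto simp: in_segment algebra_simps)
  have U: "closed_segment x y \<subseteq> U"
    using assms convex_U by (simp add: convex_contains_segment)
  have D: "((\<lambda>s. inner p (f (?c s)) - inner q (g (?c s))) has_derivative
      (\<lambda>h. inner p (f' (?c s) (h *\<^sub>R (y - x))) - inner q (g' (?c s) (h *\<^sub>R (y - x))))) (at s within {0..1})"
    if "0 \<le> s" "s \<le> 1" for s
  proof -
    have "?c s \<in> U" using seg[OF that] U by blast
    then show ?thesis
      by (intro has_derivative_diff has_derivative_inner_right
          has_derivative_compose[OF _ f_deriv] has_derivative_compose[OF _ g_deriv])
        (auto intro!: derivative_eq_intros)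
  qed
  obtain s where s: "s \<in> {0<..<1}" and eq: "inner p (f (?c 1)) - inner q (g (?c 1)) - (inner p (f (?c 0)) - inner q (g (?c 0)))
      = inner p (f' (?c s) ((1 - 0) *\<^sub>R (y - x))) - inner q (g' (?c s) ((1 - 0) *\<^sub>R (y - x)))"
    using mvt_simple[of 0 1, OF _ D] by auto
  show ?thesis
  proof
    show "?c s \<in> closed_segment x y" using s seg by simp
    then show "?c s \<in> U" using U by blast
    show "inner p (f y - f x) - inner q (g y - g x) = inner p (f' (?c s) (y - x)) - inner q (g' (?c s) (y - x))"
      using eq by (simp add: inner_diff_right)
  qed
qed

section \<open>Solutions and the separation of their differences\<close>

lemma solution_in_U: "sol \<phi> \<Longrightarrow> t \<ge> 0 \<Longrightarrow> \<phi> t \<in> U"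
  by (simp add: fwd_solution_def)

lemma solution_derivative:
  assumes "sol \<phi>" "t \<ge> 0"
  shows "((\<lambda>t. fst (\<phi> t)) has_vector_derivative f (\<phi> t)) (at t within {0..})"
    "((\<lambda>t. snd (\<phi> t)) has_vector_derivative g (\<phi> t)) (at t within {0..})"
proof -
  have "(\<phi> has_vector_derivative vfield f g (\<phi> t)) (at t within {0..})"
    using assms by (simp add: fwd_solution_def)
  from bounded_linear.has_vector_derivative[OF bounded_linear_fst this]
    bounded_linear.has_vector_derivative[OF bounded_linear_snd this]
  show "((\<lambda>t. fst (\<phi> t)) has_vector_derivative f (\<phi> t)) (at t within {0..})"
    "((\<lambda>t. snd (\<phi> t)) has_vector_derivative g (\<phi> t)) (at t within {0..})"
    by (simp_all add: vfield_def)
qed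

lemma solution_continuous:
  assumes "sol \<phi>"
  shows "continuous_on {0..} \<phi>"
  using assms unfolding fwd_solution_def continuous_on_eq_continuous_within
  by (auto intro: has_vector_derivative_continuous)

lemma difference_norm_derivatives:
  assumes "sol \<phi>" "sol \<psi>" "t \<ge> 0"
  shows "((\<lambda>t. (norm (fst (\<phi> t) - fst (\<psi> t)))\<^sup>2) has_real_derivative
      2 * inner (fst (\<phi> t) - fst (\<psi> t)) (f (\<phi> t) - f (\<psi> t))) (at t within {0..})"
    "((\<lambda>t. (norm (snd (\<phi> t) - snd (\<psi> t)))\<^sup>2) has_real_derivative
      2 * inner (snd (\<phi> t) - snd (\<psi> t)) (g (\<phi> t) - g (\<psi> t))) (at t within {0..})"
  using assms by (auto intro!: has_real_derivative_norm_power2 has_vector_derivative_diff solution_derivative)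

text \<open>Suppose \<open>P = |a|^2 - |z|^2\<close> is nonnegative at time 0. Its derivative is at
  least \<open>2 * c1 * |a|^2\<close> as long as \<open>P\<close> is nonnegative, so
  \<open>P\<close> becomes positive, stays so, and then grows at least linearly. It passes
  \<open>d^2\<close>, although the cone condition confines \<open>|a|\<close> to
  \<open>d\<close>.\<close>

lemma solutions_separate_outside_cone:
  assumes \<phi>: "sol \<phi>" and \<psi>: "sol \<psi>" and neq: "\<phi> 0 \<noteq> \<psi> 0"
  shows "norm (fst (\<phi> 0) - fst (\<psi> 0)) < norm (snd (\<phi> 0) - snd (\<psi> 0))"
proof (rule ccontr)
  assume "\<not> ?thesis"
  then have cone0: "norm (fst (\<phi> 0) - fst (\<psi> 0)) \<ge> norm (snd (\<phi> 0) - snd (\<psi> 0))"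
    by simp
  define a where "a t = fst (\<phi> t) - fst (\<psi> t)" for t
  define z where "z t = snd (\<phi> t) - snd (\<psi> t)" for t
  define P where "P t = (norm (a t))\<^sup>2 - (norm (z t))\<^sup>2" for t
  define P' where "P' t = 2 * (inner (a t) (f (\<phi> t) - f (\<psi> t)) - inner (z t) (g (\<phi> t) - g (\<psi> t)))" for t
  have P_deriv: "(P has_real_derivative P' t) (at t within {0..})" if "t \<ge> 0" for t
    unfolding P_def P'_def a_def z_def right_diff_distrib
    by (intro DERIV_diff difference_norm_derivatives \<phi> \<psi> that)
  have P'_ge: "P' t \<ge> 2 * c1 * (norm (a t))\<^sup>2" if t: "t \<ge> 0" and "P t \<ge> 0" for t
  proof -
    have le: "norm (z t) \<le> norm (a t)"
      using that by (simp add: P_def power2_le_iff_abs_le)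
    obtain w where "w \<in> U" "inner (a t) (f (\<phi> t) - f (\<psi> t)) - inner (z t) (g (\<phi> t) - g (\<psi> t))
      = inner (a t) (f' w (\<phi> t - \<psi> t)) - inner (z t) (g' w (\<phi> t - \<psi> t))"
      using mean_value solution_in_U \<phi> \<psi> t by metis
    then show ?thesis
      using cone_quadratic_form[of w "\<phi> t - \<psi> t"] le by (simp add: P'_def a_def z_def)
  qed
  \<comment> \<open>The initial value \<open>P 0\<close> may be 0. Since \<open>a 0\<close> is
    nonzero, the derivative at 0 is positive, and \<open>P\<close> is positive at the slightly later
    time \<open>t0\<close>, from which the argument restarts.\<close>
  have "a 0 \<noteq> 0"
    using neq cone0 by (auto simp: a_def prod_eq_iff)
  have P0: "P 0 \<ge> 0"
    using cone0 by (simp add: P_def a_def z_def power_mono)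
  then have "P' 0 > 0"
    using P'_ge[of 0] \<open>a 0 \<noteq> 0\<close> c1_pos
    by (meson less_le_trans mult_pos_pos order_refl zero_less_norm_iff zero_less_numeral zero_less_power)
  then obtain e where "e > 0" "\<And>h. \<lbrakk>h > 0; h < e\<rbrakk> \<Longrightarrow> P 0 < P h"
    using has_real_derivative_pos_inc_right[OF P_deriv[of 0]] by auto
  then have t0: "e / 2 > 0" "P (e / 2) > 0"
    using P0 by (auto intro: le_less_trans)
  define t0 where "t0 = e / 2"
  have P_cont: "continuous_on {0..} P"
    unfolding continuous_on_eq_continuous_within using P_deriv by (auto intro: DERIV_continuous)
  have deriv_at: "(P has_real_derivative P' t) (at t)" if "t > t0" for t
    using P_deriv[of t] that t0 at_within_Ici[of t] by (simp add: t0_def)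
  have deriv_nonneg: "\<exists>y. (P has_real_derivative y) (at r) \<and> y \<ge> 0" if "t0 < r" "P r > 0" for r
  proof -
    have "0 \<le> 2 * c1 * (norm (a r))\<^sup>2" using c1_pos by simp
    also have "\<dots> \<le> P' r" using P'_ge[of r] that t0 by (simp add: t0_def)
    finally show ?thesis using deriv_at[OF that(1)] by blast
  qed
  have mono: "P t0 \<le> P t" if "t \<ge> t0" for t
  proof (rule DERIV_nonneg_imp_increasing_open[OF that])
    fix s assume s: "t0 < s" "s < t"
    \<comment> \<open>The two functions of the bootstrap lemma are both taken to be
      \<open>P\<close>.\<close>
    have "P s > 0 \<and> P s > 0"
      by (rule both_stay_positive[where a=t0 and b=t])
        (use s t0 P_cont deriv_nonneg in \<open>auto simp: t0_def intro: continuous_on_subset\<close>)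
    then show "\<exists>y. (P has_real_derivative y) (at s) \<and> y \<ge> 0"
      using deriv_nonneg s(1) by blast
  qed (use t0 in \<open>auto intro!: continuous_on_subset[OF P_cont] simp: t0_def\<close>)
  define k where "k = 2 * c1 * P t0"
  have k: "k > 0" using t0 c1_pos by (simp add: k_def t0_def)
  \<comment> \<open>Linear growth at rate \<open>k\<close> over this time adds
    \<open>d^2 + 1\<close> to the positive value \<open>P t0\<close>.\<close>
  define T where "T = t0 + (d\<^sup>2 + 1) / k"
  have T: "T \<ge> t0" using k by (simp add: T_def)
  have "P T \<ge> P t0 + k * (T - t0)"
  proof (rule linear_growth[OF T])
    show "continuous_on {t0..T} P"
      using t0 by (auto intro!: continuous_on_subset[OF P_cont] simp: t0_def)
    fix t assume t: "t0 < t" "t < T"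
    then have "P t0 \<le> P t" using mono by simp
    then have "P t0 \<le> (norm (a t))\<^sup>2"
      by (simp add: P_def) (smt (verit) zero_le_power2)
    then have "k \<le> 2 * c1 * (norm (a t))\<^sup>2"
      using c1_pos by (simp add: k_def)
    also have "\<dots> \<le> P' t"
      using P'_ge \<open>P t0 \<le> P t\<close> t t0 by (simp add: t0_def)
    finally show "\<exists>y. (P has_real_derivative y) (at t) \<and> y \<ge> k"
      using deriv_at t by blast
  qed
  then have "P T > d\<^sup>2"
    using k t0 by (simp add: T_def t0_def)
  moreover have "\<phi> T \<in> U" "\<psi> T \<in> U"
    using T t0 \<phi> \<psi> solution_in_U by (auto simp: t0_def)
  moreover have "P T \<ge> 0"
    using mono[OF T] t0 by (simp add: t0_def)
  then have "\<phi> T \<in> lcone (\<psi> T)"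
    by (simp add: lcone_def Lfun_def P_def a_def z_def norm_minus_commute)
  ultimately have "norm (a T) \<le> d"
    using cone_in_box[of "\<psi> T"] by (auto simp: boxd_def a_def)
  then have "(norm (a T))\<^sup>2 \<le> d\<^sup>2"
    by (intro power_mono) auto
  then show False
    using \<open>P T > d\<^sup>2\<close> zero_le_power2[of "norm (z T)"] unfolding P_def by linarith
qed

lemma invariant_sets_separate:
  assumes "pos_invariant f g U S" "pos_invariant f g U S'" "x \<in> S" "y \<in> S'" "x \<noteq> y"
  shows "norm (fst x - fst y) < norm (snd x - snd y)"
proof -
  obtain \<phi> \<psi> where "sol \<phi>" "\<phi> 0 = x" "sol \<psi>" "\<psi> 0 = y"
    using assms unfolding pos_invariant_def by meson
  then show ?thesis
    using solutions_separate_outside_cone[of \<phi> \<psi>] assms(5) by auto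
qed

text \<open>This bounds the logarithmic growth rate of \<open>|z|\<close> for the linearization at
  \<open>x\<close> on vectors with \<open>|a| \<le> |z|\<close>, by
  \<open>inner_g'_le\<close>.\<close>

abbreviation "growth x \<equiv> ell x + ng x"

lemma growth_cont: "continuous_on U growth"
proof -
  \<comment> \<open>Composing \<open>g' x\<close> with the inclusion of the first factor turns
    \<open>ng x\<close> into a norm of bounded linear maps, which is continuous in
    \<open>g' x\<close>.\<close>
  let ?J = "Blinfun (\<lambda>a::real^'n. (a, 0::real^'m))"
  have J: "blinfun_apply ?J = (\<lambda>a. (a, 0))"
    by (intro bounded_linear_Blinfun_apply bounded_linear_Pair bounded_linear_ident bounded_linear_zero)
  have ng: "ng x = norm (g' x o\<^sub>L ?J)" for x
    by (simp add: norm_blinfun.rep_eq blinfun_compose.rep_eq J o_def)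
  show ?thesis
    unfolding ng
    by (intro continuous_on_add ell_cont continuous_on_norm g'_cont continuous_on_const
        bounded_bilinear.continuous_on[OF bounded_bilinear_blinfun_compose])
qed

text \<open>If the conclusion failed, \<open>|A|\<^sup>2 / N\<^sup>2 \<le> 1\<close> would grow at rate at least \<open>c1 * \<mu>\<close> up to time \<open>T\<close>.\<close>
lemma linear_cone_bound:
  fixes A :: "real \<Rightarrow> real^'n" and Z :: "real \<Rightarrow> real^'m" and N :: "real \<Rightarrow> real"
  assumes U: "\<And>t. \<lbrakk>0 < t; t < T\<rbrakk> \<Longrightarrow> \<xi> t \<in> U"
    and T: "T > 0" "c1 * \<mu> * T \<ge> 1" and \<mu>: "\<mu> > 0" and \<epsilon>: "\<epsilon> > 0" "4 * \<epsilon> \<le> c1 * \<mu>"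
    and cont: "continuous_on {0..T} N" "continuous_on {0..T} A" "continuous_on {0..T} Z"
    and N_pos: "\<And>t. N t > 0"
    and N_deriv: "\<And>t. \<lbrakk>0 < t; t < T\<rbrakk> \<Longrightarrow> (N has_real_derivative (growth (\<xi> t) + \<epsilon>) * N t) (at t)"
    and A_deriv: "\<And>t. \<lbrakk>0 < t; t < T\<rbrakk> \<Longrightarrow> (A has_vector_derivative A' t) (at t)"
    and Z_deriv: "\<And>t. \<lbrakk>0 < t; t < T\<rbrakk> \<Longrightarrow> (Z has_vector_derivative Z' t) (at t)"
    and A_err: "\<And>t. \<lbrakk>0 < t; t < T\<rbrakk> \<Longrightarrow> norm (A' t - f' (\<xi> t) (A t, Z t)) \<le> \<epsilon> * N t"
    and Z_err: "\<And>t. \<lbrakk>0 < t; t < T\<rbrakk> \<Longrightarrow> norm (Z' t - g' (\<xi> t) (A t, Z t)) \<le> \<epsilon> * N t"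
    and AN: "\<And>t. \<lbrakk>0 \<le> t; t \<le> T\<rbrakk> \<Longrightarrow> norm (A t) \<le> N t"
    and ZN: "\<And>t. \<lbrakk>0 \<le> t; t \<le> T\<rbrakk> \<Longrightarrow> norm (Z t) \<le> N t"
    and Z0: "Z 0 = 0"
  shows "(norm (A 0))\<^sup>2 \<le> \<mu> * (N 0)\<^sup>2"
proof (rule ccontr)
  assume *: "\<not> ?thesis"
  \<comment> \<open>\<open>P\<close> keeps the pair in the cone, where the form estimate applies;
    \<open>R\<close> measures by how much \<open>|A|^2 / N^2\<close> exceeds the threshold
    \<open>\<mu>\<close>. Each needs the other to be positive, hence the joint bootstrap.\<close>
  define P where "P t = (norm (A t))\<^sup>2 - (norm (Z t))\<^sup>2" for t
  define R where "R t = (norm (A t))\<^sup>2 / (N t)\<^sup>2 - \<mu>" for t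
  have R_iff: "R t > 0 \<longleftrightarrow> \<mu> * (N t)\<^sup>2 < (norm (A t))\<^sup>2" for t
    using N_pos[of t] by (simp add: R_def field_simps)
  have R0: "R 0 > 0"
    using * by (simp add: R_iff)
  have "0 \<le> \<mu> * (N 0)\<^sup>2"
    using \<mu> by simp
  then have P0: "P 0 > 0"
    unfolding P_def Z0 using * by (simp only: norm_zero zero_power2 not_le)
  have err: "\<bar>inner p (q - q')\<bar> \<le> \<epsilon> * (N t)\<^sup>2"
    if "norm p \<le> N t" "norm (q - q') \<le> \<epsilon> * N t" for t and p q q' :: "'v::euclidean_space"
  proof -
    have "\<bar>inner p (q - q')\<bar> \<le> norm p * norm (q - q')"
      by (rule Cauchy_Schwarz_ineq2)
    also have "\<dots> \<le> N t * (\<epsilon> * N t)"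
      using that N_pos[of t] by (intro mult_mono) auto
    finally show ?thesis by (simp add: power2_eq_square mult_ac)
  qed
  have derivs: "(\<exists>y. (P has_real_derivative y) (at t) \<and> y \<ge> 0) \<and> (\<exists>y. (R has_real_derivative y) (at t) \<and> y \<ge> c1 * \<mu>)"
    if t: "0 < t" "t < T" and pos: "P t > 0" "R t > 0" for t
  proof -
    let ?x = "\<xi> t" and ?v = "(A t, Z t)"
    let ?S = "(norm (A t))\<^sup>2" and ?N = "(N t)\<^sup>2"
    have N2: "?N > 0" using N_pos[of t] by simp
    have S: "\<mu> * ?N < ?S" using pos by (simp add: R_iff)
    have SN: "?S \<le> ?N" using AN[of t] t by (intro power_mono) auto
    have ZA: "norm (Z t) \<le> norm (A t)"
      using pos by (intro less_imp_le power2_less_imp_less[of "norm (Z t)"]) (auto simp: P_def)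
    have eA: "inner (A t) (A' t) \<ge> inner (A t) (f' ?x ?v) - \<epsilon> * ?N"
      using err[OF AN A_err, of t] t by (simp add: inner_diff_right abs_le_iff)
    have eZ: "inner (Z t) (Z' t) \<le> inner (Z t) (g' ?x ?v) + \<epsilon> * ?N"
      using err[OF ZN Z_err, of t] t by (simp add: inner_diff_right abs_le_iff)
    \<comment> \<open>While \<open>R\<close> is positive, \<open>c1 * |A|^2\<close> dominates
      \<open>4 * \<epsilon> * N^2\<close>; this absorbs all error terms.\<close>
    have q: "4 * \<epsilon> * ?N \<le> c1 * \<mu> * ?N" "c1 * (\<mu> * ?N) \<le> c1 * ?S" "\<epsilon> * ?S \<le> \<epsilon> * ?N"
      using \<epsilon> N2 S SN c1_pos by (auto intro!: mult_right_mono mult_left_mono)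
    have dA: "((\<lambda>t. (norm (A t))\<^sup>2) has_real_derivative 2 * inner (A t) (A' t)) (at t)"
      by (intro has_real_derivative_norm_power2 A_deriv t)
    have dZ: "((\<lambda>t. (norm (Z t))\<^sup>2) has_real_derivative 2 * inner (Z t) (Z' t)) (at t)"
      by (intro has_real_derivative_norm_power2 Z_deriv t)
    have "(P has_real_derivative 2 * inner (A t) (A' t) - 2 * inner (Z t) (Z' t)) (at t)"
      unfolding P_def by (intro DERIV_diff dA dZ)
    moreover have "0 \<le> 2 * inner (A t) (A' t) - 2 * inner (Z t) (Z' t)"
    proof -
      have "0 \<le> \<epsilon> * ?N" using \<epsilon> by simp
      moreover have "4 * (\<epsilon> * ?N) \<le> c1 * ?S" using q(1,2) by simp
      moreover have "c1 * ?S \<le> inner (A t) (f' ?x ?v) - inner (Z t) (g' ?x ?v)"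
        using cone_quadratic_form[OF U[OF t], of ?v] ZA by simp
      ultimately show ?thesis using eA eZ by linarith
    qed
    moreover have "((\<lambda>t. (N t)\<^sup>2) has_real_derivative 2 * N t * ((growth ?x + \<epsilon>) * N t)) (at t)"
      using N_deriv[OF t] by (auto intro!: derivative_eq_intros)
    then have "(R has_real_derivative
        (2 * inner (A t) (A' t) * ?N - ?S * (2 * N t * ((growth ?x + \<epsilon>) * N t))) / (?N * ?N)) (at t)"
      unfolding R_def using DERIV_diff[OF DERIV_divide[OF dA] DERIV_const[of \<mu>]] N_pos[of t] by fastforce
    moreover have "c1 * \<mu> \<le> (2 * inner (A t) (A' t) * ?N - ?S * (2 * N t * ((growth ?x + \<epsilon>) * N t))) / (?N * ?N)"
    proof -
      \<comment> \<open>In the cone \<open>|A|^2\<close> grows at relative rate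
        \<open>2 * (growth + c1)\<close> up to errors, while \<open>N^2\<close> grows at exactly
        \<open>2 * (growth + \<epsilon>)\<close>. The surplus in the quotient is
        \<open>2 * c1 * |A|^2 / N^2\<close> minus at most \<open>4 * \<epsilon>\<close>, hence at
        least \<open>c1 * \<mu>\<close>.\<close>
      have "nf ?x * (norm (A t) * norm (Z t)) \<le> nf ?x * ?S"
        using ZA by (intro mult_left_mono nf_nonneg) (simp add: power2_eq_square mult_left_mono)
      moreover have "(growth ?x + nf ?x + c1) * ?S \<le> \<alpha> ?x * ?S"
        using gap[OF U[OF t]] by (intro mult_right_mono) auto
      ultimately have "inner (A t) (A' t) \<ge> (growth ?x + c1) * ?S - \<epsilon> * ?N"
        using inner_f'_ge[OF U[OF t], of ?v] eA by (simp add: algebra_simps)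
      then have "2 * inner (A t) (A' t) - 2 * (growth ?x + \<epsilon>) * ?S \<ge> c1 * \<mu> * ?N"
        using q by (simp add: algebra_simps)
      then have "(c1 * \<mu> * ?N) * ?N \<le> (2 * inner (A t) (A' t) - 2 * (growth ?x + \<epsilon>) * ?S) * ?N"
        using N2 by (intro mult_right_mono) auto
      also have "\<dots> = 2 * inner (A t) (A' t) * ?N - ?S * (2 * N t * ((growth ?x + \<epsilon>) * N t))"
        by (simp add: algebra_simps power2_eq_square)
      finally show ?thesis
        using N2 by (intro mult_imp_le_div_pos) (simp_all add: mult.assoc)
    qed
    ultimately show ?thesis by blast
  qed
  have contP: "continuous_on {0..T} P"
    unfolding P_def by (intro continuous_intros cont)
  have contR: "continuous_on {0..T} R"
    unfolding R_def using N_pos by (intro continuous_intros cont) (simp add: less_imp_neq[symmetric])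
  have c1\<mu>: "c1 * \<mu> > 0" using c1_pos \<mu> by simp
  have pos: "P t > 0 \<and> R t > 0" if "t \<in> {0..T}" for t
    by (rule both_stay_positive[OF contP contR P0 R0 _ _ that]) (use derivs c1\<mu> in \<open>meson less_imp_le order_trans\<close>)+
  have "R T \<ge> R 0 + c1 * \<mu> * (T - 0)"
    using T(1) by (intro linear_growth contR) (use pos derivs in auto)
  then have "R T + \<mu> > 1"
    using T R0 \<mu> by simp
  moreover have "(norm (A T))\<^sup>2 \<le> (N T)\<^sup>2"
    using AN[of T] T by (intro power_mono) auto
  ultimately show False
    using N_pos[of T] by (simp add: R_def)
qed

end

subsection \<open>The invariant graph\<close>

locale invariant_graph = cone_expansion f g f' g' U \<alpha> ell c1 d
  for f :: "(real^'n) \<times> (real^'m) \<Rightarrow> real^'n" and g f' g' U \<alpha> ell c1 d +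
  fixes \<Gamma> :: "((real^'n) \<times> (real^'m)) set"
  assumes invariant: "pos_invariant f g U \<Gamma>" and projection: "snd ` \<Gamma> = snd ` U"
begin

section \<open>The function \<open>h\<close> and the maximality of \<open>\<Gamma>\<close>\<close>

abbreviation K where "K \<equiv> snd ` \<Gamma>"

text \<open>The description is proper for \<open>z\<close> in \<open>K\<close>, because two points
  of \<open>\<Gamma>\<close> with the same \<open>z\<close> coincide by separation; elsewhere the
  value is unspecified.\<close>

definition h :: "real^'m \<Rightarrow> real^'n" where "h z = (THE a. (a, z) \<in> \<Gamma>)"

definition traj where "traj \<phi> \<longleftrightarrow> sol \<phi> \<and> (\<forall>t\<ge>0. \<phi> t \<in> \<Gamma>)"

lemma trajD: "traj \<phi> \<Longrightarrow> sol \<phi>" "traj \<phi> \<Longrightarrow> t \<ge> 0 \<Longrightarrow> \<phi> t \<in> \<Gamma>" "traj \<phi> \<Longrightarrow> t \<ge> 0 \<Longrightarrow> \<phi> t \<in> U"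
  using solution_in_U by (auto simp: traj_def)

lemma open_K: "open K"
  unfolding projection by (rule open_image_snd[OF open_U])

lemma traj_exists:
  assumes "x \<in> \<Gamma>"
  obtains \<phi> where "traj \<phi>" "\<phi> 0 = x"
  using invariant assms unfolding pos_invariant_def traj_def by meson

lemma \<Gamma>_separate:
  assumes "x \<in> \<Gamma>" "y \<in> \<Gamma>" "x \<noteq> y"
  shows "norm (fst x - fst y) < norm (snd x - snd y)"
  using invariant_sets_separate invariant assms by blast

text \<open>The projections agree, so below or above every point of \<open>S\<close> there is a
  point of \<open>\<Gamma>\<close> with the same \<open>z\<close>. If the two were distinct,
  separation would make a norm smaller than 0.\<close>

lemma invariant_subset:
  assumes S: "pos_invariant f g U S"
  shows "S \<subseteq> \<Gamma>"
proof
  fix x assume x: "x \<in> S"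
  then have "x \<in> U" using S by (auto simp: pos_invariant_def)
  then obtain y where "y \<in> \<Gamma>" "snd y = snd x"
    using projection by (metis imageE imageI)
  then show "x \<in> \<Gamma>"
    using invariant_sets_separate[OF S invariant x, of y] by fastforce
qed

lemma h_eq: "x \<in> \<Gamma> \<Longrightarrow> h (snd x) = fst x"
  unfolding h_def
proof (rule the_equality)
  fix a assume "x \<in> \<Gamma>" "(a, snd x) \<in> \<Gamma>"
  then show "a = fst x"
    using \<Gamma>_separate[of x "(a, snd x)"] by (cases "x = (a, snd x)") (auto simp: prod_eq_iff)
qed simp

lemma h_mem: "z \<in> K \<Longrightarrow> (h z, z) \<in> \<Gamma>"
  using h_eq by (metis imageE prod.collapse)

lemma \<Gamma>_eq_graph: "\<Gamma> = {(h z, z) | z. z \<in> K}"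
proof (intro set_eqI iffI)
  fix x assume "x \<in> \<Gamma>"
  then have "x = (h (snd x), snd x)" "snd x \<in> K"
    by (simp_all add: h_eq)
  then show "x \<in> {(h z, z) | z. z \<in> K}" by blast
qed (use h_mem in auto)

lemma h_contraction:
  assumes "z1 \<in> K" "z2 \<in> K" "z1 \<noteq> z2"
  shows "norm (h z2 - h z1) < norm (z2 - z1)"
  using \<Gamma>_separate[of "(h z2, z2)" "(h z1, z1)"] h_mem assms by simp

section \<open>Differences of trajectories in \<open>\<Gamma>\<close>\<close>

lemma traj_cone:
  assumes "traj \<phi>" "traj \<psi>" "t \<ge> 0"
  shows "norm (fst (\<phi> t) - fst (\<psi> t)) \<le> norm (snd (\<phi> t) - snd (\<psi> t))"
  using \<Gamma>_separate[of "\<phi> t" "\<psi> t"] trajD(2) assms by (cases "\<phi> t = \<psi> t") (auto intro: less_imp_le)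

lemma traj_norm_le:
  assumes "traj \<phi>" "traj \<psi>" "t \<ge> 0"
  shows "norm (\<phi> t - \<psi> t) \<le> 2 * norm (snd (\<phi> t) - snd (\<psi> t))"
proof -
  have "norm (\<phi> t - \<psi> t) \<le> norm (fst (\<phi> t) - fst (\<psi> t)) + norm (snd (\<phi> t) - snd (\<psi> t))"
    using norm_Pair_le[of "fst (\<phi> t - \<psi> t)" "snd (\<phi> t - \<psi> t)"]
    by (simp add: prod.collapse flip: fst_diff snd_diff del: fst_diff snd_diff)
  then show ?thesis using traj_cone[OF assms] by simp
qed

lemma traj_continuous: "traj \<phi> \<Longrightarrow> continuous_on {0..T} \<phi>"
  by (rule continuous_on_subset[OF solution_continuous[OF trajD(1)]]) auto

lemma traj_curve:
  assumes "traj \<xi>"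
  shows "compact (\<xi> ` {0..T})" "\<xi> ` {0..T} \<subseteq> U"
proof -
  show "compact (\<xi> ` {0..T})"
    using traj_continuous[OF assms] by (intro compact_continuous_image) auto
  show "\<xi> ` {0..T} \<subseteq> U"
    using trajD(3)[OF assms] by auto
qed

text \<open>The quotient \<open>|z|^2 / E^2\<close> is nonincreasing, since
  \<open>|a| \<le> |z|\<close> along \<open>\<Gamma>\<close> makes \<open>k\<close> an upper bound
  for the rate of \<open>|z|\<close> inside the balls. Nearness to \<open>\<xi>\<close> is required
  only strictly before \<open>t\<close>, so \<open>t\<close> may be the first exit time.\<close>

lemma traj_growth:
  assumes \<phi>: "traj \<phi>" and \<psi>: "traj \<psi>"
    and E: "continuous_on {0..T} E" "E 0 = 1" "\<And>t. E t > 0"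
      "\<And>s. \<lbrakk>0 < s; s < T\<rbrakk> \<Longrightarrow> (E has_real_derivative k s * E s) (at s)"
    and near: "\<And>s x. \<lbrakk>0 < s; s < T; x \<in> cball (\<xi> s) r\<rbrakk> \<Longrightarrow> growth x \<le> k s"
    and in_ball: "\<And>s. \<lbrakk>0 < s; s < t\<rbrakk> \<Longrightarrow> \<phi> s \<in> cball (\<xi> s) r"
      "\<And>s. \<lbrakk>0 < s; s < t\<rbrakk> \<Longrightarrow> \<psi> s \<in> cball (\<xi> s) r"
    and t: "0 \<le> t" "t \<le> T"
  shows "norm (snd (\<phi> t) - snd (\<psi> t)) \<le> norm (snd (\<phi> 0) - snd (\<psi> 0)) * E t"
proof -
  define z where "z s = snd (\<phi> s) - snd (\<psi> s)" for s
  define G where "G s = g (\<phi> s) - g (\<psi> s)" for s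
  have z_deriv: "((\<lambda>s. (norm (z s))\<^sup>2) has_real_derivative 2 * inner (z s) (G s)) (at s within {0..})"
    if "s \<ge> 0" for s
    unfolding z_def G_def by (intro difference_norm_derivatives trajD \<phi> \<psi> that)
  have "(norm (z t))\<^sup>2 / (E t)\<^sup>2 \<le> (norm (z 0))\<^sup>2 / (E 0)\<^sup>2"
  proof (rule DERIV_nonpos_imp_decreasing_open[OF t(1)])
    fix s assume s: "0 < s" "s < t"
    \<comment> \<open>Taking \<open>p = 0\<close> leaves only the \<open>g\<close> part; convexity
      keeps \<open>w\<close> in the ball around \<open>\<xi> s\<close>, where \<open>k s\<close>
      bounds the growth.\<close>
    obtain w where w: "w \<in> closed_segment (\<psi> s) (\<phi> s)" "w \<in> U"
      "inner 0 (f (\<phi> s) - f (\<psi> s)) - inner (z s) (G s) =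
        inner 0 (f' w (\<phi> s - \<psi> s)) - inner (z s) (g' w (\<phi> s - \<psi> s))"
      unfolding G_def using mean_value[of "\<psi> s" "\<phi> s"] trajD(3) \<phi> \<psi> s by (metis less_imp_le)
    have "w \<in> cball (\<xi> s) r"
      using closed_segment_subset[OF in_ball(2,1)[OF s] convex_cball] w(1) by blast
    then have k: "growth w \<le> k s"
      using near s t by auto
    have "inner (z s) (G s) \<le> ell w * (norm (z s))\<^sup>2 + ng w * norm (fst (\<phi> s) - fst (\<psi> s)) * norm (z s)"
      using w(3) inner_g'_le[OF w(2), of "\<phi> s - \<psi> s"] by (simp add: z_def)
    also have "\<dots> \<le> ell w * (norm (z s))\<^sup>2 + ng w * norm (z s) * norm (z s)"
      using traj_cone[OF \<phi> \<psi>, of s] s ng_nonneg unfolding z_def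
      by (intro add_left_mono mult_right_mono mult_left_mono) auto
    also have "\<dots> = growth w * (norm (z s))\<^sup>2"
      by (simp add: power2_eq_square algebra_simps)
    also have "\<dots> \<le> k s * (norm (z s))\<^sup>2"
      using k by (intro mult_right_mono) auto
    finally have "2 * inner (z s) (G s) * (E s)\<^sup>2 \<le> 2 * (k s * (norm (z s))\<^sup>2) * (E s)\<^sup>2"
      by (intro mult_right_mono) auto
    then have "(2 * inner (z s) (G s) * (E s)\<^sup>2 - (norm (z s))\<^sup>2 * (2 * E s * (k s * E s))) / ((E s)\<^sup>2 * (E s)\<^sup>2) \<le> 0"
      using E(3)[of s] by (intro divide_nonpos_pos) (auto simp: power2_eq_square algebra_simps)
    moreover have "((\<lambda>s. (E s)\<^sup>2) has_real_derivative 2 * E s * (k s * E s)) (at s)"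
      using E(4)[of s] s t by (auto intro!: derivative_eq_intros)
    then have "((\<lambda>s. (norm (z s))\<^sup>2 / (E s)\<^sup>2) has_real_derivative
      (2 * inner (z s) (G s) * (E s)\<^sup>2 - (norm (z s))\<^sup>2 * (2 * E s * (k s * E s))) / ((E s)\<^sup>2 * (E s)\<^sup>2)) (at s)"
      using z_deriv[of s] E(3)[of s] s at_within_Ici[of s] by (intro DERIV_divide) auto
    ultimately show "\<exists>y. ((\<lambda>s. (norm (z s))\<^sup>2 / (E s)\<^sup>2) has_real_derivative y) (at s) \<and> y \<le> 0"
      by blast
  next
    have "continuous_on {0..} (\<lambda>s. (norm (z s))\<^sup>2)"
      unfolding continuous_on_eq_continuous_within using z_deriv by (auto intro: DERIV_continuous)
    then have "continuous_on {0..t} (\<lambda>s. (norm (z s))\<^sup>2)"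
      by (rule continuous_on_subset) auto
    then show "continuous_on {0..t} (\<lambda>s. (norm (z s))\<^sup>2 / (E s)\<^sup>2)"
      using t E(3) by (intro continuous_on_divide[OF _ continuous_on_power[OF continuous_on_subset[OF E(1)]]])
        (auto simp: less_imp_neq[symmetric])
  qed
  then have "(norm (z t))\<^sup>2 \<le> (norm (z 0) * E t)\<^sup>2"
    using E(2) E(3)[of t] by (simp add: divide_le_eq power_mult_distrib)
  then have "norm (z t) \<le> norm (z 0) * E t"
    by (rule power2_le_imp_le) (use E(3)[of t] in simp)
  then show ?thesis
    by (simp only: z_def)
qed

text \<open>Continuous dependence on initial data costs nothing here: while two trajectories stay near \<open>\<xi>\<close>,
  their distance is controlled by the \<open>z\<close>-component, which grows at most like \<open>E\<close>.\<close>
lemma traj_tracking: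
  assumes \<xi>: "traj \<xi>" and "r > 0" "\<epsilon> > 0" "T \<ge> 0"
  obtains \<delta> E where "\<delta> > 0" "continuous_on {0..T} E" "E 0 = 1" "\<And>t. E t > 0"
    "\<And>t. \<lbrakk>0 < t; t < T\<rbrakk> \<Longrightarrow> (E has_real_derivative (growth (\<xi> t) + \<epsilon>) * E t) (at t)"
    "\<And>\<phi> t. \<lbrakk>traj \<phi>; norm (snd (\<phi> 0) - snd (\<xi> 0)) < \<delta>; 0 \<le> t; t \<le> T\<rbrakk> \<Longrightarrow> \<phi> t \<in> cball (\<xi> t) r"
    "\<And>\<phi> \<psi> t. \<lbrakk>traj \<phi>; traj \<psi>; norm (snd (\<phi> 0) - snd (\<xi> 0)) < \<delta>; norm (snd (\<psi> 0) - snd (\<xi> 0)) < \<delta>;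
        0 \<le> t; t \<le> T\<rbrakk> \<Longrightarrow> norm (snd (\<phi> t) - snd (\<psi> t)) \<le> norm (snd (\<phi> 0) - snd (\<psi> 0)) * E t"
proof -
  define C where "C = \<xi> ` {0..T}"
  obtain r1 where r1: "r1 > 0" "\<And>x y. \<lbrakk>x \<in> C; y \<in> cball x r1\<rbrakk> \<Longrightarrow> dist (growth y) (growth x) < \<epsilon>"
    using uniform_nearness_on_compact[OF open_U _ _ growth_cont \<open>\<epsilon> > 0\<close>] traj_curve[OF \<xi>]
    unfolding C_def by metis
  define \<rho> where "\<rho> = min r r1"
  have \<rho>: "\<rho> > 0" "\<rho> \<le> r" using r1 \<open>r > 0\<close> by (auto simp: \<rho>_def)
  have near: "growth x \<le> growth (\<xi> s) + \<epsilon>" if "0 < s" "s < T" "x \<in> cball (\<xi> s) \<rho>" for s x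
  proof -
    have "\<xi> s \<in> C" "x \<in> cball (\<xi> s) r1"
      using that by (auto simp: C_def \<rho>_def)
    then show ?thesis using r1(2)[of "\<xi> s" x] by (simp add: dist_real_def)
  qed
  have "continuous_on {0..T} (\<lambda>t. growth (\<xi> t) + \<epsilon>)"
    by (intro continuous_on_add[OF _ continuous_on_const]
        continuous_on_compose2[OF growth_cont traj_continuous[OF \<xi>]] traj_curve(2)[OF \<xi>])
  then obtain E where E: "continuous_on {0..T} E" "E 0 = 1" "\<And>t. E t > 0"
    "\<And>t. \<lbrakk>0 < t; t < T\<rbrakk> \<Longrightarrow> (E has_real_derivative (growth (\<xi> t) + \<epsilon>) * E t) (at t)"
    using integrating_factor by blast
  obtain M where M: "\<And>t. t \<in> {0..T} \<Longrightarrow> E t \<le> M"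
    using continuous_attains_sup[OF compact_Icc _ E(1)] \<open>T \<ge> 0\<close> by force
  have "M > 0" using M[of 0] E(2) \<open>T \<ge> 0\<close> by auto
  \<comment> \<open>The whole difference is at most twice its \<open>z\<close>-component, which is
    below \<open>\<delta> * M\<close>; the factor 2 in the denominator makes the total smaller than
    \<open>\<rho>\<close>.\<close>
  define \<delta> where "\<delta> = \<rho> / (2 * M)"
  have "\<delta> > 0" using \<rho> \<open>M > 0\<close> by (simp add: \<delta>_def)
  have in_ball: "\<phi> t \<in> cball (\<xi> t) \<rho>"
    if \<phi>: "traj \<phi>" and start: "norm (snd (\<phi> 0) - snd (\<xi> 0)) < \<delta>" and t: "0 \<le> t" "t \<le> T" for \<phi> t
  proof (rule ccontr)
    assume *: "\<phi> t \<notin> cball (\<xi> t) \<rho>"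
    \<comment> \<open>At the first time with distance at least \<open>\<rho>\<close>, the growth
      bound still applies and yields a distance strictly below \<open>\<rho>\<close>.\<close>
    define B where "B = {s \<in> {0..T}. \<rho> \<le> norm (\<phi> s - \<xi> s)}"
    have "closed B"
      unfolding B_def
      by (intro continuous_on_closed_Collect_le continuous_on_norm continuous_on_diff
          continuous_on_const traj_continuous \<phi> \<xi>) auto
    moreover have "t \<in> B"
      using * t by (auto simp: B_def dist_norm norm_minus_commute)
    ultimately obtain s where s: "s \<in> {0..t}" "s \<in> B" "\<And>r. \<lbrakk>0 \<le> r; r < s\<rbrakk> \<Longrightarrow> r \<notin> B"
      using first_time_in_closed_set[of B t 0 T] t by auto
    have before: "\<phi> r \<in> cball (\<xi> r) \<rho>" if "0 < r" "r < s" for r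
      using s(3)[of r] that s(1) t by (auto simp: B_def dist_norm norm_minus_commute)
    have "norm (snd (\<phi> s) - snd (\<xi> s)) \<le> norm (snd (\<phi> 0) - snd (\<xi> 0)) * E s"
      using traj_growth[OF \<phi> \<xi> E near before, of s] s(1) t \<rho>(1) by auto
    also have "\<dots> \<le> norm (snd (\<phi> 0) - snd (\<xi> 0)) * M"
      using M[of s] s(1) t by (intro mult_left_mono) auto
    also have "\<dots> < \<delta> * M"
      using start \<open>M > 0\<close> by simp
    finally have "2 * norm (snd (\<phi> s) - snd (\<xi> s)) < \<rho>"
      using \<open>M > 0\<close> by (simp add: \<delta>_def)
    then show False
      using traj_norm_le[OF \<phi> \<xi>, of s] s(1,2) by (auto simp: B_def)
  qed
  show ?thesis
  proof
    show "\<phi> t \<in> cball (\<xi> t) r"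
      if "traj \<phi>" "norm (snd (\<phi> 0) - snd (\<xi> 0)) < \<delta>" "0 \<le> t" "t \<le> T" for \<phi> t
      using in_ball[OF that] \<rho>(2) by auto
    show "norm (snd (\<phi> t) - snd (\<psi> t)) \<le> norm (snd (\<phi> 0) - snd (\<psi> 0)) * E t"
      if "traj \<phi>" "traj \<psi>" "norm (snd (\<phi> 0) - snd (\<xi> 0)) < \<delta>" "norm (snd (\<psi> 0) - snd (\<xi> 0)) < \<delta>"
        "0 \<le> t" "t \<le> T" for \<phi> \<psi> t
      by (rule traj_growth[OF that(1,2) E near]) (use in_ball that in auto)
  qed (use \<open>\<delta> > 0\<close> E in auto)
qed

section \<open>Approximate strict derivatives of \<open>h\<close> from secant maps\<close>

lemma h_approximate_derivative:
  assumes z0: "z0 \<in> K" and e: "e > 0"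
  shows "\<exists>\<delta>>0. \<exists>A::(real^'m) \<Rightarrow>\<^sub>L (real^'n). \<forall>y\<in>ball z0 \<delta>. \<forall>w\<in>ball z0 \<delta>.
    norm (h y - h w - A (y - w)) \<le> e * norm (y - w)"
proof -
  have "\<forall>z\<in>K. \<exists>\<phi>. traj \<phi> \<and> \<phi> 0 = (h z, z)"
  proof
    fix z assume "z \<in> K"
    from h_mem[OF this] show "\<exists>\<phi>. traj \<phi> \<and> \<phi> 0 = (h z, z)"
      by (rule traj_exists) blast
  qed
  from bchoice[OF this] obtain Tr where Tr: "\<And>z. z \<in> K \<Longrightarrow> traj (Tr z)" "\<And>z. z \<in> K \<Longrightarrow> Tr z 0 = (h z, z)"
    by blast
  define \<xi> where "\<xi> = Tr z0"
  have \<xi>: "traj \<xi>" "\<xi> 0 = (h z0, z0)"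
    using Tr z0 by (auto simp: \<xi>_def)
  \<comment> \<open>\<open>C\<close> is the factor from \<open>norm_basis_combination_le\<close>.
    The value of \<open>\<mu>\<close> turns the final bound into
    \<open>(e * norm (y - w))^2\<close>, and \<open>\<epsilon>\<close> and \<open>T\<close> are the
    extreme values that \<open>linear_cone_bound\<close> admits for this
    \<open>\<mu>\<close>.\<close>
  define C where "C = 1 + real DIM(real^'m)"
  have C: "C > 0" by (simp add: C_def add_pos_nonneg)
  define \<mu> where "\<mu> = (e / C)\<^sup>2"
  define \<epsilon> where "\<epsilon> = c1 * \<mu> / 4"
  define T where "T = 1 / (c1 * \<mu>)"
  have pos: "\<mu> > 0" "\<epsilon> > 0" "T > 0"
    using e C c1_pos by (auto simp: \<mu>_def \<epsilon>_def T_def)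
  \<comment> \<open>Half of \<open>\<epsilon>\<close> is used because the full difference of two
    trajectories can be twice its \<open>z\<close>-component.\<close>
  obtain r1 where r1: "r1 > 0" "\<And>x y y'. \<lbrakk>x \<in> \<xi> ` {0..T}; y \<in> cball x r1; y' \<in> cball x r1\<rbrakk>
      \<Longrightarrow> norm (f y - f y' - f' x (y - y')) \<le> \<epsilon> / 2 * norm (y - y')"
    using strict_linearization_on_compact[OF open_U traj_curve[OF \<xi>(1)] f_deriv f'_cont, of "\<epsilon>/2"] pos
    by (metis half_gt_zero)
  obtain r2 where r2: "r2 > 0" "\<And>x y y'. \<lbrakk>x \<in> \<xi> ` {0..T}; y \<in> cball x r2; y' \<in> cball x r2\<rbrakk>
      \<Longrightarrow> norm (g y - g y' - g' x (y - y')) \<le> \<epsilon> / 2 * norm (y - y')"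
    using strict_linearization_on_compact[OF open_U traj_curve[OF \<xi>(1)] g_deriv g'_cont, of "\<epsilon>/2"] pos
    by (metis half_gt_zero)
  define r where "r = min r1 r2"
  have "r > 0" using r1 r2 by (simp add: r_def)
  obtain \<delta>0 E where \<delta>0: "\<delta>0 > 0" and E: "continuous_on {0..T} E" "E 0 = 1" "\<And>t. E t > 0"
    "\<And>t. \<lbrakk>0 < t; t < T\<rbrakk> \<Longrightarrow> (E has_real_derivative (growth (\<xi> t) + \<epsilon>) * E t) (at t)"
    and in_ball: "\<And>\<phi> t. \<lbrakk>traj \<phi>; norm (snd (\<phi> 0) - snd (\<xi> 0)) < \<delta>0; 0 \<le> t; t \<le> T\<rbrakk> \<Longrightarrow> \<phi> t \<in> cball (\<xi> t) r"
    and track: "\<And>\<phi> \<psi> t. \<lbrakk>traj \<phi>; traj \<psi>; norm (snd (\<phi> 0) - snd (\<xi> 0)) < \<delta>0; norm (snd (\<psi> 0) - snd (\<xi> 0)) < \<delta>0;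
        0 \<le> t; t \<le> T\<rbrakk> \<Longrightarrow> norm (snd (\<phi> t) - snd (\<psi> t)) \<le> norm (snd (\<phi> 0) - snd (\<psi> 0)) * E t"
    by (rule traj_tracking[OF \<xi>(1) \<open>r > 0\<close> pos(2) less_imp_le[OF pos(3)]]) (rule that; assumption)
  obtain \<delta>1 where \<delta>1: "\<delta>1 > 0" "ball z0 \<delta>1 \<subseteq> K"
    using open_K z0 open_contains_ball by blast
  define \<delta> where "\<delta> = min \<delta>0 \<delta>1"
  have \<delta>: "\<delta> > 0" "ball z0 \<delta> \<subseteq> K" using \<delta>0 \<delta>1 by (auto simp: \<delta>_def)
  have trz: "traj (Tr z)" "Tr z 0 = (h z, z)" "norm (snd (Tr z 0) - snd (\<xi> 0)) < \<delta>0" if "z \<in> ball z0 \<delta>" for z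
  proof -
    have z: "z \<in> K" using that \<delta>(2) by blast
    show "traj (Tr z)" "Tr z 0 = (h z, z)" by (intro Tr z)+
    then show "norm (snd (Tr z 0) - snd (\<xi> 0)) < \<delta>0"
      using that \<xi>(2) by (simp add: \<delta>_def dist_norm norm_minus_commute)
  qed
  define \<Delta> where "\<Delta> y w t = Tr y t - Tr w t" for y w t
  have pair_z: "norm (snd (\<Delta> y w t)) \<le> E t * norm (y - w)"
    if "y \<in> ball z0 \<delta>" "w \<in> ball z0 \<delta>" "0 \<le> t" "t \<le> T" for y w t
    using track[OF trz(1)[OF that(1)] trz(1)[OF that(2)] trz(3)[OF that(1)] trz(3)[OF that(2)] that(3,4)]
    by (simp add: \<Delta>_def trz(2)[OF that(1)] trz(2)[OF that(2)] mult.commute)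
  have pair_a: "norm (fst (\<Delta> y w t)) \<le> E t * norm (y - w)"
    if "y \<in> ball z0 \<delta>" "w \<in> ball z0 \<delta>" "0 \<le> t" "t \<le> T" for y w t
    using traj_cone[OF trz(1)[OF that(1)] trz(1)[OF that(2)] that(3)] pair_z[OF that] by (simp add: \<Delta>_def)
  have pair_norm: "\<epsilon> / 2 * norm (\<Delta> y w t) \<le> \<epsilon> * E t * norm (y - w)"
    if "y \<in> ball z0 \<delta>" "w \<in> ball z0 \<delta>" "0 \<le> t" "t \<le> T" for y w t
  proof -
    have "norm (\<Delta> y w t) \<le> 2 * (E t * norm (y - w))"
      using traj_norm_le[OF trz(1)[OF that(1)] trz(1)[OF that(2)] that(3)] pair_z[OF that] by (simp add: \<Delta>_def)
    then show ?thesis using pos(2) by simp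
  qed
  have pair_f: "norm (f (Tr y t) - f (Tr w t) - f' (\<xi> t) (\<Delta> y w t)) \<le> \<epsilon> * E t * norm (y - w)"
    and pair_g: "norm (g (Tr y t) - g (Tr w t) - g' (\<xi> t) (\<Delta> y w t)) \<le> \<epsilon> * E t * norm (y - w)"
    if "y \<in> ball z0 \<delta>" "w \<in> ball z0 \<delta>" "0 \<le> t" "t \<le> T" for y w t
  proof -
    have mem: "\<xi> t \<in> \<xi> ` {0..T}" "Tr y t \<in> cball (\<xi> t) r" "Tr w t \<in> cball (\<xi> t) r"
      using that in_ball trz by auto
    show "norm (f (Tr y t) - f (Tr w t) - f' (\<xi> t) (\<Delta> y w t)) \<le> \<epsilon> * E t * norm (y - w)"
      using r1(2)[of "\<xi> t" "Tr y t" "Tr w t"] mem pair_norm[OF that] by (simp add: r_def \<Delta>_def)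
    show "norm (g (Tr y t) - g (Tr w t) - g' (\<xi> t) (\<Delta> y w t)) \<le> \<epsilon> * E t * norm (y - w)"
      using r2(2)[of "\<xi> t" "Tr y t" "Tr w t"] mem pair_norm[OF that] by (simp add: r_def \<Delta>_def)
  qed
  \<comment> \<open>The basis increments have a fixed length that does not depend on
    \<open>y\<close> and \<open>w\<close>, so a single secant map serves the whole ball.\<close>
  define s where "s = \<delta> / 2"
  have s: "s > 0" using \<delta> by (simp add: s_def)
  have zi: "z0 + s *\<^sub>R i \<in> ball z0 \<delta>" if "i \<in> Basis" for i
    using that \<delta>(1) by (simp add: s_def dist_norm)
  have z0': "z0 \<in> ball z0 \<delta>" using \<delta>(1) by simp
  define A where "A = Blinfun (\<lambda>v. \<Sum>i\<in>Basis. (inner v i / s) *\<^sub>R (h (z0 + s *\<^sub>R i) - h z0))"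
  have A: "blinfun_apply A = (\<lambda>v. \<Sum>i\<in>Basis. (inner v i / s) *\<^sub>R (h (z0 + s *\<^sub>R i) - h z0))"
    unfolding A_def by (intro bounded_linear_Blinfun_apply bounded_linear_sum bounded_linear_scaleR_left[THEN bounded_linear_compose]
        bounded_linear_divide[THEN bounded_linear_compose] bounded_linear_inner_left)
  \<comment> \<open>The secant map \<open>A\<close> is chosen so that the combination \<open>W\<close> below has no \<open>z\<close>-component at time 0.\<close>
  have "norm (h y - h w - A (y - w)) \<le> e * norm (y - w)" if y: "y \<in> ball z0 \<delta>" and w: "w \<in> ball z0 \<delta>" for y w
  proof (cases "y = w")
    case False
    define c where "c i = inner (y - w) i / s" for i
    define W where "W t = \<Delta> y w t - (\<Sum>i\<in>Basis. c i *\<^sub>R \<Delta> (z0 + s *\<^sub>R i) z0 t)" for t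
    define F where "F t = f (Tr y t) - f (Tr w t) - (\<Sum>i\<in>Basis. c i *\<^sub>R (f (Tr (z0 + s *\<^sub>R i) t) - f (Tr z0 t)))" for t
    define G where "G t = g (Tr y t) - g (Tr w t) - (\<Sum>i\<in>Basis. c i *\<^sub>R (g (Tr (z0 + s *\<^sub>R i) t) - g (Tr z0 t)))" for t
    \<comment> \<open>A common bound for both components of \<open>W\<close>: each difference is
      controlled by \<open>E\<close> times its initial \<open>z\<close>-distance, and the
      combination costs the factor \<open>C\<close>.\<close>
    define N where "N t = C * norm (y - w) * E t" for t
    have W_parts: "fst (W t) = fst (\<Delta> y w t) - (\<Sum>i\<in>Basis. c i *\<^sub>R fst (\<Delta> (z0 + s *\<^sub>R i) z0 t))"
      "snd (W t) = snd (\<Delta> y w t) - (\<Sum>i\<in>Basis. c i *\<^sub>R snd (\<Delta> (z0 + s *\<^sub>R i) z0 t))" for t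
      by (simp_all add: W_def fst_sum snd_sum)
    \<comment> \<open>The coefficients \<open>c i\<close> expand \<open>y - w\<close> in the
      increments \<open>s *\<^sub>R i\<close>, so the \<open>z\<close>-components cancel, and the
      \<open>a\<close>-component is exactly the error of the secant map.\<close>
    have W0: "W 0 = (h y - h w - A (y - w), 0)"
      using trz(2)[OF y] trz(2)[OF w] trz(2)[OF zi] trz(2)[OF z0'] s euclidean_representation[of "y - w"]
      by (intro prod_eqI) (simp_all add: W_parts \<Delta>_def A c_def)
    have Wderiv: "((\<lambda>t. fst (W t)) has_vector_derivative F t) (at t)"
      "((\<lambda>t. snd (W t)) has_vector_derivative G t) (at t)" if t: "0 < t" "t < T" for t
    proof -
      have der: "((\<lambda>t. fst (Tr z t)) has_vector_derivative f (Tr z t)) (at t)"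
        "((\<lambda>t. snd (Tr z t)) has_vector_derivative g (Tr z t)) (at t)" if "z \<in> ball z0 \<delta>" for z
        using solution_derivative[OF trajD(1)[OF trz(1)[OF that]], of t] t at_within_Ici[of t] by auto
      note rules = has_vector_derivative_diff has_vector_derivative_sum
        bounded_linear.has_vector_derivative[OF bounded_linear_scaleR_right]
      show "((\<lambda>t. fst (W t)) has_vector_derivative F t) (at t)"
        unfolding W_parts F_def \<Delta>_def fst_diff by (intro rules der(1) y w zi z0')
      show "((\<lambda>t. snd (W t)) has_vector_derivative G t) (at t)"
        unfolding W_parts G_def \<Delta>_def snd_diff by (intro rules der(2) y w zi z0')
    qed
    have Wcont: "continuous_on {0..T} W"
      unfolding W_def \<Delta>_def by (intro continuous_intros traj_continuous trz(1) y w zi z0')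
    have "(norm (fst (W 0)))\<^sup>2 \<le> \<mu> * (N 0)\<^sup>2"
    proof (rule linear_cone_bound[where A = "\<lambda>t. fst (W t)" and Z = "\<lambda>t. snd (W t)" and T = T and \<xi> = \<xi> and \<epsilon> = \<epsilon> and A' = F and Z' = G])
      show "\<xi> t \<in> U" if "0 < t" for t using trajD(3)[OF \<xi>(1)] that by simp
      show "N t > 0" for t using C E(3)[of t] False by (simp add: N_def)
      show "(N has_real_derivative (growth (\<xi> t) + \<epsilon>) * N t) (at t)" if "0 < t" "t < T" for t
        unfolding N_def using DERIV_cmult[OF E(4)[OF that], of "C * norm (y - w)"] by (simp add: mult_ac)
      show "norm (fst (W t)) \<le> N t" if t: "0 \<le> t" "t \<le> T" for t
        unfolding W_parts N_def C_def c_def using E(3)[of t] s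
          pair_a[OF y w t] pair_a[OF zi z0' t]
        by (intro norm_basis_combination_le) auto
      show "norm (snd (W t)) \<le> N t" if t: "0 \<le> t" "t \<le> T" for t
        unfolding W_parts N_def C_def c_def using E(3)[of t] s
          pair_z[OF y w t] pair_z[OF zi z0' t]
        by (intro norm_basis_combination_le) auto
      show "norm (F t - f' (\<xi> t) (fst (W t), snd (W t))) \<le> \<epsilon> * N t" if t: "0 < t" "t < T" for t
      proof -
        have t': "0 \<le> t" "t \<le> T" using t by auto
        \<comment> \<open>By linearity of \<open>f' (\<xi> t)\<close> the residual of
          \<open>W\<close> is the same combination of the residuals of the pairs, so the combination
          bound applies with \<open>\<epsilon> * E t\<close> in place of \<open>E t\<close>.\<close>
        have "F t - f' (\<xi> t) (W t) = (f (Tr y t) - f (Tr w t) - f' (\<xi> t) (\<Delta> y w t)) -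
            (\<Sum>i\<in>Basis. c i *\<^sub>R (f (Tr (z0 + s *\<^sub>R i) t) - f (Tr z0 t) - f' (\<xi> t) (\<Delta> (z0 + s *\<^sub>R i) z0 t)))"
          by (simp add: F_def W_def blinfun.diff_right blinfun.sum_right blinfun.scaleR_right
              scaleR_diff_right sum_subtractf sum.distrib algebra_simps)
        also have "norm \<dots> \<le> C * norm (y - w) * (\<epsilon> * E t)"
          unfolding C_def c_def using E(3)[of t] s pos(2) pair_f[OF y w t'] pair_f[OF zi z0' t']
          by (intro norm_basis_combination_le) auto
        finally show ?thesis by (simp add: N_def mult_ac)
      qed
      show "norm (G t - g' (\<xi> t) (fst (W t), snd (W t))) \<le> \<epsilon> * N t" if t: "0 < t" "t < T" for t
      proof -
        have t': "0 \<le> t" "t \<le> T" using t by auto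
        have "G t - g' (\<xi> t) (W t) = (g (Tr y t) - g (Tr w t) - g' (\<xi> t) (\<Delta> y w t)) -
            (\<Sum>i\<in>Basis. c i *\<^sub>R (g (Tr (z0 + s *\<^sub>R i) t) - g (Tr z0 t) - g' (\<xi> t) (\<Delta> (z0 + s *\<^sub>R i) z0 t)))"
          by (simp add: G_def W_def blinfun.diff_right blinfun.sum_right blinfun.scaleR_right
              scaleR_diff_right sum_subtractf sum.distrib algebra_simps)
        also have "norm \<dots> \<le> C * norm (y - w) * (\<epsilon> * E t)"
          unfolding C_def c_def using E(3)[of t] s pos(2) pair_g[OF y w t'] pair_g[OF zi z0' t']
          by (intro norm_basis_combination_le) auto
        finally show ?thesis by (simp add: N_def mult_ac)
      qed
      show "continuous_on {0..T} N" unfolding N_def by (intro continuous_intros E)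
    qed (use pos c1_pos Wderiv W0 Wcont in \<open>auto simp: \<epsilon>_def T_def intro!: continuous_intros\<close>)
    also have "\<dots> = (e * norm (y - w))\<^sup>2"
      using C by (simp add: \<mu>_def N_def E(2) power_mult_distrib power_divide)
    finally have "norm (fst (W 0)) \<le> e * norm (y - w)"
      by (rule power2_le_imp_le) (use e in simp)
    then show ?thesis by (simp only: W0 fst_conv)
  qed simp
  then show ?thesis
    using \<delta>(1) by blast
qed

text \<open>The strict inequality between distinct points would only give norm at most 1 in the
  limit. A uniform constant comes from running the trajectories for unit time: if the ratio
  \<open>|a|^2 / |z|^2\<close> started above \<open>1 - \<eta>\<close>, it would rise at rate
  \<open>c1 / 2\<close> and exceed 1.\<close>

lemma h_local_contraction:
  assumes z0: "z0 \<in> K"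
  obtains \<theta> \<delta> where "0 \<le> \<theta>" "\<theta> < 1" "\<delta> > 0"
    "\<And>w. w \<in> ball z0 \<delta> \<Longrightarrow> norm (h w - h z0) \<le> \<theta> * norm (w - z0)"
proof -
  obtain \<xi> where \<xi>: "traj \<xi>" "\<xi> 0 = (h z0, z0)"
    using traj_exists[OF h_mem[OF z0]] by metis
  define C where "C = \<xi> ` {0..1}"
  have C: "compact C" "C \<subseteq> U" using traj_curve[OF \<xi>(1)] by (auto simp: C_def)
  obtain r1 where r1: "r1 > 0" "\<And>x y. \<lbrakk>x \<in> C; y \<in> cball x r1\<rbrakk> \<Longrightarrow> dist (\<alpha> y) (\<alpha> x) < 1"
    using uniform_nearness_on_compact[OF open_U C alpha_cont zero_less_one] by metis
  obtain r2 where r2: "r2 > 0" "\<And>x y. \<lbrakk>x \<in> C; y \<in> cball x r2\<rbrakk> \<Longrightarrow> dist (g' y) (g' x) < 1"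
    using uniform_nearness_on_compact[OF open_U C g'_cont zero_less_one] by metis
  have "bounded (\<alpha> ` C)" "bounded (g' ` C)"
    using C alpha_cont g'_cont
    by (auto intro!: compact_imp_bounded compact_continuous_image intro: continuous_on_subset)
  then obtain M1 M2 where M12: "\<And>x. x \<in> C \<Longrightarrow> \<bar>\<alpha> x\<bar> \<le> M1" "\<And>x. x \<in> C \<Longrightarrow> norm (g' x) \<le> M2"
    unfolding bounded_iff by auto
  define M where "M = M1 + 1"
  define M' where "M' = M2 + 1"
  define r where "r = min r1 r2"
  have r: "r > 0" using r1 r2 by (simp add: r_def)
  have \<alpha>M: "\<alpha> x \<le> M" and gM: "norm (g' x) \<le> M'" if "t \<in> {0..1}" "x \<in> cball (\<xi> t) r" for t x
  proof -
    have "\<xi> t \<in> C" "x \<in> cball (\<xi> t) r1" "x \<in> cball (\<xi> t) r2"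
      using that by (auto simp: C_def r_def)
    then show "\<alpha> x \<le> M" "norm (g' x) \<le> M'"
      using r1(2)[of "\<xi> t" x] r2(2)[of "\<xi> t" x] M12[of "\<xi> t"] norm_triangle_ineq2[of "g' x" "g' (\<xi> t)"]
      by (auto simp: dist_norm M_def M'_def)
  qed
  have "\<xi> 0 \<in> C" by (simp add: C_def)
  then have M: "M > 0" "M' \<ge> 0"
    using M12(1)[of "\<xi> 0"] order_trans[OF norm_ge_zero M12(2)[of "\<xi> 0"]] by (auto simp: M_def M'_def)
  \<comment> \<open>The bound \<open>1/2\<close> keeps \<open>|a| / |z|\<close> at least
    \<open>1/2\<close>, the bound \<open>c1 / (2 * M)\<close> limits the loss from
    \<open>|a| < |z|\<close> to half of \<open>c1\<close>, and the bound \<open>c1 / 2\<close> makes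
    unit time long enough to pass 1.\<close>
  define \<eta> where "\<eta> = min (1/2) (min (c1 / (2 * M)) (c1 / 2))"
  have \<eta>: "\<eta> > 0" "\<eta> \<le> 1/2" "\<eta> \<le> c1 / 2" "\<eta> * M \<le> c1 / 2"
  proof -
    have "\<eta> * M \<le> c1 / (2 * M) * M" using M by (intro mult_right_mono) (auto simp: \<eta>_def)
    then show "\<eta> * M \<le> c1 / 2" using M by simp
  qed (use c1_pos M in \<open>auto simp: \<eta>_def\<close>)
  obtain \<delta>0 where \<delta>0: "\<delta>0 > 0" and
    in_ball: "\<And>\<phi> t. \<lbrakk>traj \<phi>; norm (snd (\<phi> 0) - snd (\<xi> 0)) < \<delta>0; 0 \<le> t; t \<le> 1\<rbrakk> \<Longrightarrow> \<phi> t \<in> cball (\<xi> t) r"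
    by (rule traj_tracking[OF \<xi>(1) r zero_less_one zero_le_one]) (rule that; assumption)
  obtain \<delta>1 where \<delta>1: "\<delta>1 > 0" "ball z0 \<delta>1 \<subseteq> K"
    using open_K z0 open_contains_ball by blast
  define \<delta> where "\<delta> = min \<delta>0 \<delta>1"
  have "norm (h w - h z0) \<le> sqrt (1 - \<eta>) * norm (w - z0)" if w: "w \<in> ball z0 \<delta>" for w
  proof (cases "w = z0")
    case False
    have "w \<in> K" using w \<delta>1 by (auto simp: \<delta>_def)
    then obtain \<phi> where \<phi>: "traj \<phi>" "\<phi> 0 = (h w, w)"
      using traj_exists[OF h_mem] by metis
    define a where "a t = fst (\<phi> t) - fst (\<xi> t)" for t
    define z where "z t = snd (\<phi> t) - snd (\<xi> t)" for t
    define F where "F t = f (\<phi> t) - f (\<xi> t)" for t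
    define G where "G t = g (\<phi> t) - g (\<xi> t)" for t
    have ball: "\<phi> t \<in> cball (\<xi> t) r" "\<xi> t \<in> cball (\<xi> t) r" if "t \<in> {0..1}" for t
      using in_ball[OF \<phi>(1), of t] w \<phi>(2) \<xi>(2) that r by (auto simp: \<delta>_def dist_norm norm_minus_commute)
    have mv: "\<exists>x\<in>cball (\<xi> t) r. x \<in> U \<and> inner p (F t) - inner q (G t)
        = inner p (f' x (\<phi> t - \<xi> t)) - inner q (g' x (\<phi> t - \<xi> t))" if "t \<in> {0..1}" for p q t
    proof -
      have "\<xi> t \<in> U" "\<phi> t \<in> U"
        using trajD(3) \<phi>(1) \<xi>(1) that by auto
      then obtain x where "x \<in> closed_segment (\<xi> t) (\<phi> t)" "x \<in> U" "inner p (F t) - inner q (G t)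
        = inner p (f' x (\<phi> t - \<xi> t)) - inner q (g' x (\<phi> t - \<xi> t))"
        by (rule mean_value[of "\<xi> t" "\<phi> t" p q, folded F_def G_def]) (rule that; assumption)
      then show ?thesis
        using closed_segment_subset[OF ball(2,1)[OF that] convex_cball] by blast
    qed
    have az: "norm (a t) \<le> norm (z t)" if "t \<ge> 0" for t
      using traj_cone[OF \<phi>(1) \<xi>(1) that] by (simp add: a_def z_def)
    have derivs: "((\<lambda>t. (norm (a t))\<^sup>2) has_real_derivative 2 * inner (a t) (F t)) (at t within {0..})"
      "((\<lambda>t. (norm (z t))\<^sup>2) has_real_derivative 2 * inner (z t) (G t)) (at t within {0..})"
      if "t \<ge> 0" for t
      unfolding a_def z_def F_def G_def by (intro difference_norm_derivatives trajD(1) \<phi> \<xi> that)+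
    have conts: "continuous_on {0..t} (\<lambda>t. (norm (a t))\<^sup>2)" "continuous_on {0..t} (\<lambda>t. (norm (z t))\<^sup>2)" for t
    proof -
      have "continuous_on {0..} (\<lambda>t. (norm (a t))\<^sup>2)" "continuous_on {0..} (\<lambda>t. (norm (z t))\<^sup>2)"
        unfolding continuous_on_eq_continuous_within by (intro ballI DERIV_continuous[OF derivs(1)]; simp)
          (intro ballI DERIV_continuous[OF derivs(2)]; simp)
      then show "continuous_on {0..t} (\<lambda>t. (norm (a t))\<^sup>2)" "continuous_on {0..t} (\<lambda>t. (norm (z t))\<^sup>2)"
        by (auto intro: continuous_on_subset)
    qed
    \<comment> \<open>The ratio needs a nonzero denominator. As \<open>g'\<close> is bounded near
      the curve and the full difference is at most twice \<open>|z|\<close>, the square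
      \<open>|z|^2\<close> decays at most at rate \<open>4 * M'\<close> and never reaches 0.\<close>
    have z_pos: "norm (z t) > 0" if t: "t \<in> {0..1}" for t
    proof -
      have "(norm (z 0))\<^sup>2 * exp (4 * M' * 0) \<le> (norm (z t))\<^sup>2 * exp (4 * M' * t)"
      proof (rule DERIV_nonneg_imp_increasing_open[where f="\<lambda>t. (norm (z t))\<^sup>2 * exp (4 * M' * t)" and a=0 and b=t])
        fix s assume s: "0 < s" "s < t"
        then have "s \<in> {0..1}" using t by auto
        then obtain x where x: "x \<in> cball (\<xi> s) r" "- inner (z s) (G s) = - inner (z s) (g' x (\<phi> s - \<xi> s))"
          using mv[of s 0 "z s"] by auto
        have "\<bar>inner (z s) (g' x (\<phi> s - \<xi> s))\<bar> \<le> norm (z s) * (norm (g' x) * norm (\<phi> s - \<xi> s))"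
          by (intro order_trans[OF Cauchy_Schwarz_ineq2] mult_left_mono norm_blinfun) auto
        also have "\<dots> \<le> norm (z s) * (M' * (2 * norm (z s)))"
          using gM[OF \<open>s \<in> {0..1}\<close> x(1)] traj_norm_le[OF \<phi>(1) \<xi>(1), of s] s M
          by (intro mult_left_mono mult_mono) (auto simp: z_def)
        also have "\<dots> = 2 * M' * (norm (z s))\<^sup>2"
          by (simp add: power2_eq_square)
        finally have "0 \<le> 2 * inner (z s) (G s) + 4 * M' * (norm (z s))\<^sup>2"
          using x(2) by linarith
        then have "0 \<le> (2 * inner (z s) (G s) + 4 * M' * (norm (z s))\<^sup>2) * exp (4 * M' * s)"
          by (intro mult_nonneg_nonneg) auto
        moreover have "((\<lambda>t. (norm (z t))\<^sup>2 * exp (4 * M' * t)) has_real_derivative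
            2 * inner (z s) (G s) * exp (4 * M' * s) + exp (4 * M' * s) * (4 * M') * (norm (z s))\<^sup>2) (at s)"
          using derivs(2)[of s] s at_within_Ici[of s]
          by (intro DERIV_mult) (auto intro!: derivative_eq_intros)
        ultimately show "\<exists>y. ((\<lambda>t. (norm (z t))\<^sup>2 * exp (4 * M' * t)) has_real_derivative y) (at s) \<and> 0 \<le> y"
          by (intro exI conjI) (assumption, simp add: algebra_simps)
      next
        show "continuous_on {0..t} (\<lambda>t. (norm (z t))\<^sup>2 * exp (4 * M' * t))"
          by (intro continuous_on_mult conts(2) continuous_on_exp continuous_on_const continuous_on_id)
      qed (use t in simp)
      moreover have "z 0 \<noteq> 0" using False \<phi>(2) \<xi>(2) by (simp add: z_def)
      ultimately show ?thesis by (auto simp: mult_le_0_iff)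
    qed
    define \<rho> where "\<rho> t = (norm (a t))\<^sup>2 / (norm (z t))\<^sup>2" for t
    have \<rho>_cont: "continuous_on {0..1} \<rho>"
      unfolding \<rho>_def using z_pos by (intro continuous_on_divide conts) fastforce
    have \<rho>_le: "\<rho> t \<le> 1" if "t \<in> {0..1}" for t
      using az[of t] z_pos[OF that] that by (simp add: \<rho>_def divide_le_eq power_mono)
    have \<rho>_deriv: "\<exists>y. (\<rho> has_real_derivative y) (at t) \<and> y \<ge> c1 / 2"
      if t: "0 < t" "t < 1" and \<rho>: "\<rho> t > 1 - \<eta>" for t
    proof -
      have t': "t \<in> {0..1}" "t \<ge> 0" using t by auto
      define s where "s = norm (a t) / norm (z t)"
      let ?z = "norm (z t)"
      have z: "?z > 0" using z_pos t' by blast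
      have a: "norm (a t) = s * ?z" using z by (simp add: s_def)
      have \<rho>s: "\<rho> t = s\<^sup>2" by (simp add: s_def \<rho>_def power_divide)
      have s01: "0 \<le> s" "s \<le> 1" using az[OF t'(2)] z by (auto simp: s_def divide_le_eq)
      \<comment> \<open>A lower bound on the squared ratio passes to the ratio itself:
        \<open>1 - s\<close> is at most \<open>1 - s^2\<close>, which is below
        \<open>\<eta>\<close>.\<close>
      have "s\<^sup>2 \<le> s" using s01 by (simp add: power2_eq_square mult_left_le)
      then have s\<eta>: "1 - s \<le> \<eta>" using \<rho> \<rho>s by linarith
      \<comment> \<open>Weighting \<open>z t\<close> by \<open>\<rho> t\<close> makes the left side
        equal to \<open>|z|^2 / 2\<close> times the derivative of \<open>\<rho>\<close>, with both
        components evaluated at the same point \<open>x\<close>.\<close>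
      obtain x where x: "x \<in> cball (\<xi> t) r" "x \<in> U" "inner (a t) (F t) - inner (\<rho> t *\<^sub>R z t) (G t)
        = inner (a t) (f' x (\<phi> t - \<xi> t)) - inner (\<rho> t *\<^sub>R z t) (g' x (\<phi> t - \<xi> t))"
        using mv[OF t'(1)] by metis
      have "inner (a t) (F t) - \<rho> t * inner (z t) (G t) \<ge>
          (\<alpha> x * (norm (a t))\<^sup>2 - nf x * norm (a t) * ?z) - s\<^sup>2 * (ell x * ?z\<^sup>2 + ng x * norm (a t) * ?z)"
        using inner_f'_ge[OF x(2), of "\<phi> t - \<xi> t"] mult_left_mono[OF inner_g'_le[OF x(2), of "\<phi> t - \<xi> t"], of "s\<^sup>2"] x(3)
        by (simp add: a_def z_def \<rho>s)
      also have "(\<alpha> x * (norm (a t))\<^sup>2 - nf x * norm (a t) * ?z) - s\<^sup>2 * (ell x * ?z\<^sup>2 + ng x * norm (a t) * ?z)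
          = s * ?z\<^sup>2 * (\<alpha> x * s - nf x - s * ell x - s\<^sup>2 * ng x)"
        unfolding a by (simp add: power2_eq_square algebra_simps)
      finally have 1: "inner (a t) (F t) - \<rho> t * inner (z t) (G t) \<ge> s * ?z\<^sup>2 * (\<alpha> x * s - nf x - s * ell x - s\<^sup>2 * ng x)" .
      \<comment> \<open>Replacing \<open>\<alpha> x * s\<close> by \<open>\<alpha> x\<close> costs
        at most \<open>c1 / 2\<close>, and the gap condition provides \<open>c1\<close>.\<close>
      have "s * ell x \<le> 1 * ell x" "s\<^sup>2 * ng x \<le> 1 * ng x"
        by (intro mult_right_mono power_le_one s01 ell_nonneg[OF x(2)] ng_nonneg)+
      moreover have "\<alpha> x * (1 - s) \<le> c1 / 2"
      proof -
        have "\<alpha> x * (1 - s) \<le> M * \<eta>"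
          using \<alpha>M[OF t'(1) x(1)] s\<eta> s01 M by (intro mult_mono) auto
        then show ?thesis using \<eta>(4) by (simp add: mult.commute)
      qed
      ultimately have "\<alpha> x * s - nf x - s * ell x - s\<^sup>2 * ng x \<ge> c1 / 2"
        using gap[OF x(2)] by (simp add: algebra_simps)
      then have "(1/2) * ?z\<^sup>2 * (c1 / 2) \<le> s * ?z\<^sup>2 * (\<alpha> x * s - nf x - s * ell x - s\<^sup>2 * ng x)"
        using s\<eta> \<eta>(2) s01 c1_pos by (intro mult_mono) auto
      moreover have "(1/2) * ?z\<^sup>2 * (c1 / 2) = c1 / 4 * ?z\<^sup>2"
        by simp
      ultimately have 2: "c1 / 4 * ?z\<^sup>2 \<le> inner (a t) (F t) - \<rho> t * inner (z t) (G t)"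
        using 1 by linarith
      let ?y = "(2 * inner (a t) (F t) * ?z\<^sup>2 - (norm (a t))\<^sup>2 * (2 * inner (z t) (G t))) / (?z\<^sup>2 * ?z\<^sup>2)"
      have der: "(\<rho> has_real_derivative ?y) (at t)"
        unfolding \<rho>_def using derivs[OF t'(2)] at_within_Ici[OF t(1)] z by (intro DERIV_divide) auto
      have y_eq: "?y = 2 * (inner (a t) (F t) - \<rho> t * inner (z t) (G t)) / ?z\<^sup>2"
        using z by (simp add: \<rho>_def field_simps)
      have "c1 / 2 \<le> 2 * (inner (a t) (F t) - \<rho> t * inner (z t) (G t)) / ?z\<^sup>2"
        by (rule mult_imp_le_div_pos) (use 2 z in simp_all)
      then show ?thesis
        using der[unfolded y_eq] by blast
    qed
    have "\<rho> 0 \<le> 1 - \<eta>"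
    proof (rule ccontr)
      assume "\<not> \<rho> 0 \<le> 1 - \<eta>"
      have nonneg: "\<exists>y. ((\<lambda>t. \<rho> t - (1 - \<eta>)) has_real_derivative y) (at t) \<and> y \<ge> 0"
        if "0 < t" "t < 1" "\<rho> t - (1 - \<eta>) > 0" for t
      proof -
        have "\<rho> t > 1 - \<eta>" using that(3) by simp
        from \<rho>_deriv[OF that(1,2) this] obtain y where "(\<rho> has_real_derivative y) (at t)" "y \<ge> c1 / 2"
          by blast
        then show ?thesis
          using DERIV_diff[OF _ DERIV_const, of \<rho> y t UNIV "1 - \<eta>"] c1_pos by (intro exI[of _ y]) simp
      qed
      have cont: "continuous_on {0..1} (\<lambda>t. \<rho> t - (1 - \<eta>))"
        by (intro continuous_on_diff \<rho>_cont continuous_on_const)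
      have above: "\<rho> t > 1 - \<eta>" if "t \<in> {0..1}" for t
        using both_stay_positive[OF cont cont _ _ nonneg nonneg that] \<open>\<not> \<rho> 0 \<le> 1 - \<eta>\<close> by simp
      \<comment> \<open>The growth over unit time gives a value above
        \<open>1 - \<eta> + c1 / 2\<close>, which is at least 1, whereas the ratio never exceeds 1
        on \<open>\<Gamma>\<close>.\<close>
      have "\<rho> 1 \<ge> \<rho> 0 + c1 / 2 * (1 - 0)"
        by (intro linear_growth \<rho>_cont \<rho>_deriv above) auto
      then show False
        using \<open>\<not> \<rho> 0 \<le> 1 - \<eta>\<close> \<rho>_le[of 1] \<eta>(3) by simp
    qed
    then have "(norm (a 0))\<^sup>2 \<le> (1 - \<eta>) * (norm (z 0))\<^sup>2"
      using z_pos[of 0] by (simp add: \<rho>_def divide_le_eq)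
    also have "\<dots> = (sqrt (1 - \<eta>) * norm (z 0))\<^sup>2"
      using \<eta> by (simp add: power_mult_distrib)
    finally have "norm (a 0) \<le> sqrt (1 - \<eta>) * norm (z 0)"
      by (rule power2_le_imp_le) (use \<eta> in auto)
    then show ?thesis
      by (simp add: a_def z_def \<phi>(2) \<xi>(2))
  qed simp
  moreover have "sqrt (1 - \<eta>) < 1" "0 \<le> sqrt (1 - \<eta>)" "\<delta> > 0"
    using \<eta> \<delta>0 \<delta>1 by (auto simp: \<delta>_def)
  ultimately show ?thesis
    using that by blast
qed

section \<open>Continuous differentiability of \<open>h\<close> and the strict bound on its
  derivative\<close>

lemma h_C1:
  obtains h' :: "real^'m \<Rightarrow> (real^'m) \<Rightarrow>\<^sub>L (real^'n)" where
    "\<And>z. z \<in> K \<Longrightarrow> (h has_derivative blinfun_apply (h' z)) (at z)" "continuous_on K h'"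
    "\<And>z. z \<in> K \<Longrightarrow> onorm (blinfun_apply (h' z)) < 1"
proof -
  have "\<forall>z\<in>K. \<exists>A::(real^'m) \<Rightarrow>\<^sub>L (real^'n). \<forall>e>0. \<exists>\<delta>>0. \<forall>y\<in>ball z \<delta>. \<forall>w\<in>ball z \<delta>.
      norm (h y - h w - A (y - w)) \<le> e * norm (y - w)"
    using strict_derivative_from_approximate[OF h_approximate_derivative] by metis
  then obtain h' :: "real^'m \<Rightarrow> (real^'m) \<Rightarrow>\<^sub>L (real^'n)" where h':
    "\<And>z e. \<lbrakk>z \<in> K; e > 0\<rbrakk> \<Longrightarrow> \<exists>\<delta>>0. \<forall>y\<in>ball z \<delta>. \<forall>w\<in>ball z \<delta>.
      norm (h y - h w - h' z (y - w)) \<le> e * norm (y - w)"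
    by metis
  note C1 = C1_from_strict_derivatives[OF open_K h']
  show ?thesis
  proof (rule that[of h'])
    fix z assume z: "z \<in> K"
    show "(h has_derivative blinfun_apply (h' z)) (at z)"
      by (rule C1(1)) (use z in auto)
    obtain \<theta> \<delta> where \<theta>: "0 \<le> \<theta>" "\<theta> < 1" "\<delta> > 0"
      "\<And>w. w \<in> ball z \<delta> \<Longrightarrow> norm (h w - h z) \<le> \<theta> * norm (w - z)"
      using h_local_contraction[OF z] by metis
    \<comment> \<open>The local constant \<open>\<theta>\<close> is strictly below 1 before the
      limit is taken, so the operator norm inherits a strict bound.\<close>
    have "onorm (h' z) \<le> \<theta>"
      using derivative_bound_of_local_lipschitz[OF \<open>(h has_derivative _) _\<close> \<theta>(3,4)] \<theta>(1)
      by (intro onorm_bound) auto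
    then show "onorm (h' z) < 1" using \<theta>(2) by simp
  qed (rule C1(2))
qed

end

theorem theorem1p1:
  fixes f :: "(real^'n) \<times> (real^'m) \<Rightarrow> real^'n"
    and g :: "(real^'n) \<times> (real^'m) \<Rightarrow> real^'m"
    and f' :: "(real^'n) \<times> (real^'m) \<Rightarrow> ((real^'n) \<times> (real^'m)) \<Rightarrow>\<^sub>L (real^'n)"
    and g' :: "(real^'n) \<times> (real^'m) \<Rightarrow> ((real^'n) \<times> (real^'m)) \<Rightarrow>\<^sub>L (real^'m)"
    and U \<Gamma> :: "((real^'n) \<times> (real^'m)) set"
    and \<alpha> ell :: "(real^'n) \<times> (real^'m) \<Rightarrow> real"
    and c1 :: real
  assumes H1_open: "open U" and H1_convex: "convex U"
    and H1_cone: "\<exists>d>0. \<forall>x\<in>U. lcone x \<inter> U \<subseteq> boxd d x"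
    and H2_f_deriv: "\<And>x. x \<in> U \<Longrightarrow> (f has_derivative blinfun_apply (f' x)) (at x)"
    and H2_g_deriv: "\<And>x. x \<in> U \<Longrightarrow> (g has_derivative blinfun_apply (g' x)) (at x)"
    and H2_f'_cont: "continuous_on U f'"
    and H2_g'_cont: "continuous_on U g'"
    and H2_alpha_cont: "continuous_on U \<alpha>" and H2_alpha_pos: "\<And>x. x \<in> U \<Longrightarrow> \<alpha> x > 0"
    and H2_ell_cont: "continuous_on U ell" and H2_ell_nonneg: "\<And>x. x \<in> U \<Longrightarrow> ell x \<ge> 0"
    and H2_c1: "c1 > 0"
    and H2_Daf: "\<And>x a'. x \<in> U \<Longrightarrow> inner a' (f' x (a', 0)) \<ge> \<alpha> x * (norm a')\<^sup>2"
    and H2_Dzg: "\<And>x z'. x \<in> U \<Longrightarrow> inner z' (g' x (0, z')) \<le> ell x * (norm z')\<^sup>2"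
    and H2_ineq: "\<And>x. x \<in> U \<Longrightarrow>
        \<alpha> x \<ge> ell x + onorm (\<lambda>z'. f' x (0, z')) + onorm (\<lambda>a'. g' x (a', 0)) + c1"
    and H3_sub: "\<Gamma> \<subseteq> U"
    and H3_inv: "pos_invariant f g U \<Gamma>"
    and H3_proj: "snd ` \<Gamma> = snd ` U"
  shows "(\<forall>S. S \<subseteq> U \<and> pos_invariant f g U S \<longrightarrow> S \<subseteq> \<Gamma>) \<and>
         (\<exists>h :: real^'m \<Rightarrow> real^'n. \<exists>h' :: real^'m \<Rightarrow> (real^'m) \<Rightarrow>\<^sub>L (real^'n).
            (\<forall>z\<in>snd ` \<Gamma>. (h has_derivative blinfun_apply (h' z)) (at z within snd ` \<Gamma>)) \<and>
            continuous_on (snd ` \<Gamma>) h' \<and>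
            \<Gamma> = {(h z, z) | z. z \<in> snd ` \<Gamma>} \<and>
            (\<forall>z1\<in>snd ` \<Gamma>. \<forall>z2\<in>snd ` \<Gamma>. z1 \<noteq> z2 \<longrightarrow> norm (h z2 - h z1) < norm (z2 - z1)) \<and>
            (\<forall>z\<in>snd ` \<Gamma>. onorm (blinfun_apply (h' z)) < 1))"
proof -
  obtain d where d: "\<And>x. x \<in> U \<Longrightarrow> lcone x \<inter> U \<subseteq> boxd d x"
    using H1_cone by blast
  interpret invariant_graph f g f' g' U \<alpha> ell c1 d \<Gamma>
    by unfold_locales (fact d | fact assms)+
  obtain h' :: "real^'m \<Rightarrow> (real^'m) \<Rightarrow>\<^sub>L (real^'n)" where h':
    "\<And>z. z \<in> snd ` \<Gamma> \<Longrightarrow> (h has_derivative blinfun_apply (h' z)) (at z)" "continuous_on (snd ` \<Gamma>) h'"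
    "\<And>z. z \<in> snd ` \<Gamma> \<Longrightarrow> onorm (blinfun_apply (h' z)) < 1"
    using h_C1 by metis
  show ?thesis
  proof (intro conjI exI[of _ h] exI[of _ h'])
    show "\<forall>S. S \<subseteq> U \<and> pos_invariant f g U S \<longrightarrow> S \<subseteq> \<Gamma>"
      using invariant_subset by blast
    show "\<forall>z\<in>snd ` \<Gamma>. (h has_derivative blinfun_apply (h' z)) (at z within snd ` \<Gamma>)"
      using h'(1) has_derivative_at_withinI by blast
    show "\<Gamma> = {(h z, z) | z. z \<in> snd ` \<Gamma>}"
      by (rule \<Gamma>_eq_graph)
    show "\<forall>z1\<in>snd ` \<Gamma>. \<forall>z2\<in>snd ` \<Gamma>. z1 \<noteq> z2 \<longrightarrow> norm (h z2 - h z1) < norm (z2 - z1)"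
      using h_contraction by blast
  qed (use h' in auto)
qed

end
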